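(* Let $\varphi=(\varphi_g)_{g=1}^G\in L_2(\Omega_A)^G$ be given, with coefficient vectors $\varphi_{jk}=((\varphi_{jk})_g)_{g=1}^G\in\mathbb{C}^G$, $(\varphi_{jk})_g:=\langle\varphi_g,w_{jk}\rangle_{L_2(\Omega_A)}$, $j,k\in\mathbb{Z}$. For every $l\in\{1,\dots,L\}$ let $$a_l:=\Big\{(2T)\,\frac{c_{l,g}^{-1}}{\sigma_{jk,g}^2}\,w_{jk}\Big(-\frac{\alpha_g h_l}{c_{l,g}}\Big)(\varphi_{jk})_g\Big\}_{j,k\in\mathbb{Z},\,g=1,\dots,G},\qquad \sigma_{jk,g}:=\sqrt{\sum_{l'=1}^L c_{l',g}^{-2}},$$ and assume that $a_l\in R(F_l)$ (the range of $F_l$) for all $l\in\{1,\dots,L\}$. Then: (i) $\mathcal{A}\varphi$ is a solution of the equation $A\phi=\varphi$. (ii) For every solution $\psi=(\psi_l)_{l=1}^L\in\mathcal{D}(A)$ of $A\psi=\varphi$, $$\sum_{g=1}^G\sum_{l=1}^L\sum_{j,k\in\mathbb{Z}}\big|\langle(\mathcal{A}\varphi)_l,w_{jk,lg}\rangle_{L_2(\Omega_l)}\big|^2\le\sum_{g=1}^G\sum_{l=1}^L\sum_{j,k\in\mathbb{Z}}\big|\langle\psi_l,w_{jk,lg}\rangle_{L_2(\Omega_l)}\big|^2 .$$ (iii) Among all expansions of $\mathcal{A}\varphi$ in terms of the functions $\tilde w_{jk,lg}$, the one defining $\mathcal{A}\varphi$ is the most economical, in the following sense: for each $l$, the expansion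 of $(\mathcal{A}\varphi)_l$ in the definition of $\mathcal{A}$ has coefficient sequence $a_l$, and if $(\mathcal{A}\varphi)_l=\sum_{g=1}^G\sum_{j,k\in\mathbb{Z}}b_{jk,g}\,\tilde w_{jk,lg}$ for some square-summable sequence $b=\{b_{jk,g}\}$ with $b\ne a_l$, then $\sum_{g}\sum_{j,k}|b_{jk,g}|^2>\sum_{g}\sum_{j,k}|(a_l)_{jk,g}|^2$.
   Context: Setting. Let $\Omega_A\subset\mathbb{R}^2$ be a (measurable) set (telescope aperture). There are $L\ge1$ layers at heights $0\le h_1<\dots<h_L$ and $G=G_{\mathrm{NGS}}+G_{\mathrm{LGS}}\ge1$ guide stars with directions $\alpha_g\in\mathbb{R}^2$, $g=1,\dots,G$; $h_{\mathrm{LGS}}>h_L$ is a given height. Put $c_{l,g}=1$ for $g\in\{1,\dots,G_{\mathrm{NGS}}\}$ and $c_{l,g}=1-h_l/h_{\mathrm{LGS}}$ for $g\in\{G_{\mathrm{NGS}}+1,\dots,G\}$, so $0<c_{l,g}\le1$. Let $\Omega_A(\alpha_gh_l):=c_{l,g}\Omega_A+\alpha_gh_l$ and $\Omega_l:=\bigcup_{g=1}^G(c_{l,g}\Omega_A+\alpha_gh_l)$. The atmospheric tomography operator is $A:\mathcal{D}(A):=\prod_{l=1}^L L_2(\Omega_l)\to L_2(\Omega_A)^G$, $(A\phi)_g(r):=\sum_{l=1}^L\phi_l(c_{l,g}r+\alpha_gh_l)$, $g=1,\dots,G$. All $L_2$ spaces are complex with $\langle f,h\rangle=\int f\overline{h}$;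 product spaces carry the sum inner products $\langle\phi,\psi\rangle=\sum_l\langle\phi_l,\psi_l\rangle_{L_2(\Omega_l)}$ and $\langle\varphi,\psi\rangle=\sum_g\langle\varphi_g,\psi_g\rangle_{L_2(\Omega_A)}$. Let $T>0$, $\Omega_T:=[-T,T]^2$, with $T$ so large that $\Omega_A\subset\Omega_T$ and $\Omega_l\subset c_{l,g}\Omega_T$ for all $l,g$. For $j,k\in\mathbb{Z}$ let $w_{jk}(x,y):=\frac{1}{2T}e^{ij\omega x}e^{ik\omega y}$, $\omega:=\pi/T$, and $$w_{jk,lg}(x,y):=c_{l,g}^{-1}w_{jk}((x,y)/c_{l,g})\,I_{c_{l,g}\Omega_A+\alpha_gh_l}(x,y),$$ where $I_M$ is the indicator function of $M$. For fixed $l$, $\{w_{jk,lg}\}_{j,k\in\mathbb{Z},\,g=1,\dots,G}$ is a frame of $L_2(\Omega_l)$. (A family $\{e_k\}_{k\in K}$, $K$ countable, in a Hilbert space $H$ is a frame with frame bounds $B_1,B_2>0$ if $B_1\|f\|^2\le\sum_k|\langle f,e_k\rangle|^2\le B_2\|f\|^2$ for all $f\in H$; its frame operator is $F:H\to\ell_2(K)$, $f\mapsto\{\langle f,e_k\rangle\}_k$; with $S:=F^*F$ its dual frame is $\{S^{-1}e_k\}_k$.) $F_l$ denotes the frame operator of $\{w_{jk,lg}\}_{j,k,g}$ on $L_2(\Omega_l)$ and $\{\tilde w_{jk,lg}\}_{j,k,g}$ its dual frame. For $j,k\in\mathbb{Z}$ let $A_{jk}\in\mathbb{C}^{G\times(LG)}$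 be the block diagonal matrix whose $g$-th row has, in column $l+(g-1)L$, the entry $(2T)c_{l,g}^{-1}w_{jk}(\alpha_gh_l/c_{l,g})$, $l=1,\dots,L$, and zeros elsewhere. Let $(\sigma_{jk,n},u_{jk,n},v_{jk,n})_{n=1}^{r_{jk}}$ be a singular system of $A_{jk}$, i.e. $r_{jk}$ is the rank of $A_{jk}$, $\sigma_{jk,n}>0$, the $u_{jk,n}\in\mathbb{C}^G$ are orthonormal, the $v_{jk,n}\in\mathbb{C}^{LG}$ are orthonormal, and $A_{jk}z=\sum_{n=1}^{r_{jk}}\sigma_{jk,n}(v_{jk,n}^Hz)u_{jk,n}$ for all $z\in\mathbb{C}^{LG}$ ($H$ is the conjugate transpose). The operator $\mathcal{A}:L_2(\Omega_A)^G\to\prod_{l=1}^LL_2(\Omega_l)$ is defined by $$(\mathcal{A}\varphi)_l:=\sum_{g=1}^G\sum_{j,k\in\mathbb{Z}}\Big(\sum_{n=1}^{r_{jk}}\frac{u_{jk,n}^H\varphi_{jk}}{\sigma_{jk,n}}(v_{jk,n})_{l+(g-1)L}\Big)\tilde w_{jk,lg},\qquad l=1,\dots,L.$$ The value of the inner sum over $n$ does not depend on the choice of singular system. *)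

theory Defs
  imports "HOL-Analysis.Analysis" "Jordan_Normal_Form.DL_Rank"
begin

text \<open>
  Elements of \<open>L\<^sub>2\<close> are handled through square-integrable representatives; equality in \<open>L\<^sub>2\<close> is
  equality almost everywhere.
\<close>

definition L2 :: "'a measure \<Rightarrow> ('a \<Rightarrow> complex) set" where
  "L2 M = {f. f \<in> borel_measurable M \<and> integrable M (\<lambda>x. (cmod (f x))\<^sup>2)}"

definition L2_eq :: "'a measure \<Rightarrow> ('a \<Rightarrow> complex) \<Rightarrow> ('a \<Rightarrow> complex) \<Rightarrow> bool" where
  "L2_eq M f g \<longleftrightarrow> (AE x in M. f x = g x)"

definition L2_inner :: "'a measure \<Rightarrow> ('a \<Rightarrow> complex) \<Rightarrow> ('a \<Rightarrow> complex) \<Rightarrow> complex" where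
  "L2_inner M f g = (LINT x|M. f x * cnj (g x))"

definition L2_norm :: "'a measure \<Rightarrow> ('a \<Rightarrow> complex) \<Rightarrow> real" where
  "L2_norm M f = sqrt (LINT x|M. (cmod (f x))\<^sup>2)"

text \<open>Unconditional convergence in \<open>L\<^sub>2\<close> norm, the analogue of \<^const>\<open>has_sum\<close>.\<close>

definition L2_has_sum ::
    "'a measure \<Rightarrow> ('k \<Rightarrow> 'a \<Rightarrow> complex) \<Rightarrow> 'k set \<Rightarrow> ('a \<Rightarrow> complex) \<Rightarrow> bool" where
  "L2_has_sum M f K s \<longleftrightarrow> s \<in> L2 M \<and> (\<forall>k\<in>K. f k \<in> L2 M) \<and>
     ((\<lambda>F. L2_norm M (\<lambda>x. s x - (\<Sum>k\<in>F. f k x))) \<longlongrightarrow> 0) (finite_subsets_at_top K)"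

definition L2_infsum :: "'a measure \<Rightarrow> ('k \<Rightarrow> 'a \<Rightarrow> complex) \<Rightarrow> 'k set \<Rightarrow> ('a \<Rightarrow> complex)" where
  "L2_infsum M f K = (SOME s. L2_has_sum M f K s)"

text \<open>Families indexed by \<open>K\<close> are extensional, so that equality of functions is equality on \<open>K\<close>.\<close>

definition ell2 :: "'k set \<Rightarrow> ('k \<Rightarrow> complex) set" where
  "ell2 K = {a \<in> extensional K. (\<lambda>k. (cmod (a k))\<^sup>2) summable_on K}"

definition ell2_inner :: "'k set \<Rightarrow> ('k \<Rightarrow> complex) \<Rightarrow> ('k \<Rightarrow> complex) \<Rightarrow> complex" where
  "ell2_inner K a b = (\<Sum>\<^sub>\<infinity>k\<in>K. a k * cnj (b k))"

definition frame_op ::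
    "'a measure \<Rightarrow> 'k set \<Rightarrow> ('k \<Rightarrow> 'a \<Rightarrow> complex) \<Rightarrow> ('a \<Rightarrow> complex) \<Rightarrow> 'k \<Rightarrow> complex" where
  "frame_op M K e f = (\<lambda>k\<in>K. L2_inner M f (e k))"

text \<open>
  The Hilbert space adjoint of the frame operator, the operator \<open>S = F\<^sup>* F\<close> and the dual frame
  \<open>S\<^sup>-\<^sup>1 e\<^sub>k\<close>.  For a frame the functions selected by \<open>SOME\<close> exist and are unique up to
  null sets.
\<close>

definition frame_adj ::
    "'a measure \<Rightarrow> 'k set \<Rightarrow> ('k \<Rightarrow> 'a \<Rightarrow> complex) \<Rightarrow> ('k \<Rightarrow> complex) \<Rightarrow> 'a \<Rightarrow> complex" where
  "frame_adj M K e a =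
     (SOME g. g \<in> L2 M \<and> (\<forall>f\<in>L2 M. ell2_inner K (frame_op M K e f) a = L2_inner M f g))"

definition frame_S ::
    "'a measure \<Rightarrow> 'k set \<Rightarrow> ('k \<Rightarrow> 'a \<Rightarrow> complex) \<Rightarrow> ('a \<Rightarrow> complex) \<Rightarrow> 'a \<Rightarrow> complex" where
  "frame_S M K e f = frame_adj M K e (frame_op M K e f)"

definition dual_frame ::
    "'a measure \<Rightarrow> 'k set \<Rightarrow> ('k \<Rightarrow> 'a \<Rightarrow> complex) \<Rightarrow> 'k \<Rightarrow> 'a \<Rightarrow> complex" where
  "dual_frame M K e k = (SOME g. g \<in> L2 M \<and> L2_eq M (frame_S M K e g) (e k))"

text \<open>
  Recall that \<open>x \<bullet>c y\<close> is conjugate linear in its second argument, so that \<open>v\<^sup>H z\<close> is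
  \<open>z \<bullet>c v\<close>.
\<close>

abbreviation mat_rank :: "complex mat \<Rightarrow> nat" where
  "mat_rank A \<equiv> vec_space.rank (dim_row A) A"

definition orthonormal_fam :: "nat \<Rightarrow> nat \<Rightarrow> (nat \<Rightarrow> complex Matrix.vec) \<Rightarrow> bool" where
  "orthonormal_fam d r u \<longleftrightarrow> (\<forall>n<r. u n \<in> carrier_vec d) \<and>
     (\<forall>m<r. \<forall>n<r. u m \<bullet>c u n = (if m = n then 1 else 0))"

definition singular_system ::
    "complex mat \<Rightarrow> (nat \<Rightarrow> real) \<Rightarrow> (nat \<Rightarrow> complex Matrix.vec) \<Rightarrow> (nat \<Rightarrow> complex Matrix.vec)
       \<Rightarrow> bool" where
  "singular_system A s u v \<longleftrightarrow>
     (\<forall>n<mat_rank A. s n > 0) \<and>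
     orthonormal_fam (dim_row A) (mat_rank A) u \<and>
     orthonormal_fam (dim_col A) (mat_rank A) v \<and>
     (\<forall>z\<in>carrier_vec (dim_col A). \<forall>i<dim_row A.
        vec_index (mult_mat_vec A z) i =
          (\<Sum>n<mat_rank A. complex_of_real (s n) * (z \<bullet>c v n) * vec_index (u n) i))"

text \<open>
  The data of the tomography problem.  Layers are numbered \<open>0, \<dots>, L - 1\<close> and guide stars
  \<open>0, \<dots>, G - 1\<close>, the natural guide stars coming first.
\<close>

record tomography =
  layers :: nat
  ngs :: nat
  lgs :: nat
  height :: "nat \<Rightarrow> real"
  lgs_height :: real
  direction :: "nat \<Rightarrow> real \<times> real"
  aperture :: "(real \<times> real) set"
  period :: real

definition stars :: "tomography \<Rightarrow> nat" where
  "stars P = ngs P + lgs P"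

definition cone :: "tomography \<Rightarrow> nat \<Rightarrow> nat \<Rightarrow> real" where
  "cone P l g = (if g < ngs P then 1 else 1 - height P l / lgs_height P)"

definition footprint :: "tomography \<Rightarrow> nat \<Rightarrow> nat \<Rightarrow> (real \<times> real) set" where
  "footprint P l g = (\<lambda>r. cone P l g *\<^sub>R r + height P l *\<^sub>R direction P g) ` aperture P"

definition layer_domain :: "tomography \<Rightarrow> nat \<Rightarrow> (real \<times> real) set" where
  "layer_domain P l = (\<Union>g<stars P. footprint P l g)"

definition period_square :: "tomography \<Rightarrow> (real \<times> real) set" where
  "period_square P = {- period P..period P} \<times> {- period P..period P}"

definition valid_tomography :: "tomography \<Rightarrow> bool" where
  "valid_tomography P \<longleftrightarrow>
     layers P \<ge> 1 \<and> stars P \<ge> 1 \<and>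
     0 \<le> height P 0 \<and> strict_mono_on {..<layers P} (height P) \<and>
     height P (layers P - 1) < lgs_height P \<and>
     aperture P \<in> sets lebesgue \<and>
     period P > 0 \<and> aperture P \<subseteq> period_square P \<and>
     (\<forall>l<layers P. \<forall>g<stars P. layer_domain P l \<subseteq> (*\<^sub>R) (cone P l g) ` period_square P)"

abbreviation aperture_measure :: "tomography \<Rightarrow> (real \<times> real) measure" where
  "aperture_measure P \<equiv> lebesgue_on (aperture P)"

abbreviation layer_measure :: "tomography \<Rightarrow> nat \<Rightarrow> (real \<times> real) measure" where
  "layer_measure P l \<equiv> lebesgue_on (layer_domain P l)"

definition tomo_domain :: "tomography \<Rightarrow> (nat \<Rightarrow> real \<times> real \<Rightarrow> complex) set" where
  "tomo_domain P = (\<Pi> l\<in>{..<layers P}. L2 (layer_measure P l))"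

definition tomo_codomain :: "tomography \<Rightarrow> (nat \<Rightarrow> real \<times> real \<Rightarrow> complex) set" where
  "tomo_codomain P = (\<Pi> g\<in>{..<stars P}. L2 (aperture_measure P))"

definition tomo_op ::
    "tomography \<Rightarrow> (nat \<Rightarrow> real \<times> real \<Rightarrow> complex) \<Rightarrow> nat \<Rightarrow> real \<times> real \<Rightarrow> complex" where
  "tomo_op P \<phi> g r =
     (\<Sum>l<layers P. \<phi> l (cone P l g *\<^sub>R r + height P l *\<^sub>R direction P g))"

definition is_solution ::
    "tomography \<Rightarrow> (nat \<Rightarrow> real \<times> real \<Rightarrow> complex) \<Rightarrow> (nat \<Rightarrow> real \<times> real \<Rightarrow> complex) \<Rightarrow> bool" where
  "is_solution P \<phi> \<psi> \<longleftrightarrow> \<psi> \<in> tomo_domain P \<and>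
     (\<forall>g<stars P. L2_eq (aperture_measure P) (tomo_op P \<psi> g) (\<phi> g))"

definition w :: "tomography \<Rightarrow> int \<Rightarrow> int \<Rightarrow> real \<times> real \<Rightarrow> complex" where
  "w P j k p = complex_of_real (1 / (2 * period P))
     * exp (\<i> * complex_of_real (of_int j * (pi / period P) * fst p))
     * exp (\<i> * complex_of_real (of_int k * (pi / period P) * snd p))"

text \<open>
  The frame on a layer is indexed by triples \<open>(g, j, k)\<close>.  A double sum over \<open>g\<close> and \<open>(j, k)\<close> of
  \<open>L\<^sub>2\<close> functions is the unconditional sum over this index set.
\<close>

definition frame_idx :: "tomography \<Rightarrow> (nat \<times> int \<times> int) set" where
  "frame_idx P = {..<stars P} \<times> UNIV \<times> UNIV"

definition layer_frame ::
    "tomography \<Rightarrow> nat \<Rightarrow> nat \<times> int \<times> int \<Rightarrow> real \<times> real \<Rightarrow> complex" where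
  "layer_frame P l = (\<lambda>(g, j, k) x.
     complex_of_real (inverse (cone P l g)) * w P j k (x /\<^sub>R cone P l g)
       * indicator (footprint P l g) x)"

definition layer_frame_op ::
    "tomography \<Rightarrow> nat \<Rightarrow> (real \<times> real \<Rightarrow> complex) \<Rightarrow> nat \<times> int \<times> int \<Rightarrow> complex" where
  "layer_frame_op P l = frame_op (layer_measure P l) (frame_idx P) (layer_frame P l)"

definition layer_dual_frame ::
    "tomography \<Rightarrow> nat \<Rightarrow> nat \<times> int \<times> int \<Rightarrow> real \<times> real \<Rightarrow> complex" where
  "layer_dual_frame P l = dual_frame (layer_measure P l) (frame_idx P) (layer_frame P l)"

text \<open>The block entry for layer \<open>l\<close> and guide star \<open>g\<close> is in row \<open>g\<close> and column \<open>l + g * L\<close>.\<close>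

definition tomo_mat :: "tomography \<Rightarrow> int \<Rightarrow> int \<Rightarrow> complex mat" where
  "tomo_mat P j k = mat (stars P) (layers P * stars P) (\<lambda>(g, i).
     if i div layers P = g
     then (let l = i mod layers P in
       complex_of_real (2 * period P * inverse (cone P l g))
         * w P j k ((height P l / cone P l g) *\<^sub>R direction P g))
     else 0)"

definition data_coeff ::
    "tomography \<Rightarrow> (nat \<Rightarrow> real \<times> real \<Rightarrow> complex) \<Rightarrow> int \<Rightarrow> int \<Rightarrow> complex Matrix.vec" where
  "data_coeff P \<phi> j k = Matrix.vec (stars P) (\<lambda>g. L2_inner (aperture_measure P) (\<phi> g) (w P j k))"

text \<open>
  In the next two definitions \<open>s j k\<close>, \<open>u j k\<close>, \<open>v j k\<close> is a singular system of the matrix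
  \<open>tomo_mat P j k\<close>.
\<close>

definition inv_coeff ::
    "tomography \<Rightarrow> (int \<Rightarrow> int \<Rightarrow> nat \<Rightarrow> real) \<Rightarrow> (int \<Rightarrow> int \<Rightarrow> nat \<Rightarrow> complex Matrix.vec)
       \<Rightarrow> (int \<Rightarrow> int \<Rightarrow> nat \<Rightarrow> complex Matrix.vec) \<Rightarrow> (nat \<Rightarrow> real \<times> real \<Rightarrow> complex)
       \<Rightarrow> nat \<Rightarrow> nat \<times> int \<times> int \<Rightarrow> complex" where
  "inv_coeff P s u v \<phi> l = (\<lambda>(g, j, k)\<in>frame_idx P.
     \<Sum>n<mat_rank (tomo_mat P j k).
       (data_coeff P \<phi> j k \<bullet>c u j k n) / complex_of_real (s j k n)
         * vec_index (v j k n) (l + g * layers P))"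

definition tomo_inv ::
    "tomography \<Rightarrow> (int \<Rightarrow> int \<Rightarrow> nat \<Rightarrow> real) \<Rightarrow> (int \<Rightarrow> int \<Rightarrow> nat \<Rightarrow> complex Matrix.vec)
       \<Rightarrow> (int \<Rightarrow> int \<Rightarrow> nat \<Rightarrow> complex Matrix.vec) \<Rightarrow> (nat \<Rightarrow> real \<times> real \<Rightarrow> complex)
       \<Rightarrow> nat \<Rightarrow> real \<times> real \<Rightarrow> complex" where
  "tomo_inv P s u v \<phi> l =
     L2_infsum (layer_measure P l)
       (\<lambda>i x. inv_coeff P s u v \<phi> l i * layer_dual_frame P l i x) (frame_idx P)"

definition row_norm :: "tomography \<Rightarrow> nat \<Rightarrow> real" where
  "row_norm P g = sqrt (\<Sum>l<layers P. inverse ((cone P l g)\<^sup>2))"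

definition a_seq ::
    "tomography \<Rightarrow> (nat \<Rightarrow> real \<times> real \<Rightarrow> complex) \<Rightarrow> nat \<Rightarrow> nat \<times> int \<times> int \<Rightarrow> complex" where
  "a_seq P \<phi> l = (\<lambda>(g, j, k)\<in>frame_idx P.
     complex_of_real (2 * period P * (inverse (cone P l g) / (row_norm P g)\<^sup>2))
       * w P j k (- ((height P l / cone P l g) *\<^sub>R direction P g))
       * vec_index (data_coeff P \<phi> j k) g)"

end

theory Submission
  imports Defs
begin

text \<open>
  The point of the proof is that the operator \<open>S = F\<^sup>* F\<close> of each layer frame is multiplication by
  a function.  The exponentials \<open>w P j k\<close> are orthonormal on the period square and their span is
  dense there, by Weierstrass approximation on the torus, so their restrictions to any measurable
  subset satisfy Parseval's identity (\<open>Parseval_subset\<close>).  Transporting this identity from the aperture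
  to a footprint by the affine map \<open>r \<mapsto> c r + \<alpha> h\<close>, which only multiplies the exponentials by
  unimodular constants, and summing over the guide stars gives
  \<open>\<Sum> |\<langle>f, e\<^sub>i\<rangle>|\<^sup>2 = \<integral> N |f|\<^sup>2\<close>, where \<open>N x\<close> counts the footprints that contain \<open>x\<close>.
  By polarization \<open>S\<close> is multiplication by \<open>N\<close>, and the dual frame is
  \<open>e\<^sub>i / N\<close>.  The facts about dual frames that are needed, namely the reconstruction formula
  \<open>f = \<Sum> \<langle>f, e\<^sub>i\<rangle> S\<^sup>-\<^sup>1 e\<^sub>i\<close> and the Pythagorean identity
  \<open>\<parallel>b\<parallel>\<^sup>2 = \<parallel>F f\<parallel>\<^sup>2 + \<parallel>b - F f\<parallel>\<^sup>2\<close> for every other expansion \<open>b\<close> of \<open>f\<close>, follow from the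
  weighted Parseval identity alone (\<open>dual_expansion\<close>, \<open>dual_expansion_energy\<close>).

  On the side of the coefficients, the equation \<open>A \<psi> = \<phi>\<close> decouples: for each \<open>j\<close>, \<open>k\<close> and each
  guide star \<open>g\<close>, the numbers \<open>\<langle>\<psi>\<^sub>l, w\<^sub>j\<^sub>k\<^sub>,\<^sub>l\<^sub>g\<rangle>\<close> satisfy one scalar linear equation whose
  coefficients are row \<open>g\<close> of \<open>A\<^sub>j\<^sub>k\<close> (\<open>tomo_op_L2\<close>).  The rows have disjoint supports, so
  \<open>A\<^sub>j\<^sub>k A\<^sub>j\<^sub>k\<^sup>H\<close> is diagonal with entries \<open>\<sigma>\<^sub>j\<^sub>k\<^sub>,\<^sub>g\<^sup>2\<close>, and the pseudoinverse, whatever singular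
  system computes it, yields exactly the sequences \<open>a\<^sub>l\<close> (\<open>inv_coeff_eq_a_seq\<close>).

  If \<open>a\<^sub>l = F\<^sub>l f\<^sub>l\<close>, reconstruction identifies component \<open>l\<close> of the inverse with \<open>f\<^sub>l\<close>, so its frame
  coefficients are again \<open>a\<^sub>l\<close>.  Hence its image under \<open>A\<close> has the Fourier coefficients of \<open>\<phi>\<close>,
  which gives (i) by completeness.  The \<open>a\<^sub>l\<close> are the minimum-norm solutions of the scalar
  equations that the coefficients of every solution satisfy, which gives (ii).  The Pythagorean
  identity gives (iii).
\<close>

section \<open>Square-integrable functions\<close>

lemma L2_measurable: "f \<in> L2 M \<Longrightarrow> f \<in> borel_measurable M"
  and L2_integrable_norm: "f \<in> L2 M \<Longrightarrow> integrable M (\<lambda>x. (cmod (f x))\<^sup>2)"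
  by (auto simp: L2_def)

lemma L2I:
  "f \<in> borel_measurable M \<Longrightarrow> integrable M (\<lambda>x. (cmod (f x))\<^sup>2) \<Longrightarrow> f \<in> L2 M"
  by (auto simp: L2_def)

lemma norm_add_sq_le: "(cmod (a + b))\<^sup>2 \<le> 2 * (cmod a)\<^sup>2 + 2 * (cmod b)\<^sup>2"
proof -
  have "(cmod (a + b))\<^sup>2 \<le> (cmod a + cmod b)\<^sup>2"
    by (intro power_mono norm_triangle_ineq) auto
  also have "\<dots> \<le> 2 * (cmod a)\<^sup>2 + 2 * (cmod b)\<^sup>2"
    using sum_squares_ge_zero[of "cmod a - cmod b" 0] by (simp add: power2_eq_square algebra_simps)
  finally show ?thesis .
qed

lemma borel_measurable_cnj [measurable]:
  "f \<in> borel_measurable M \<Longrightarrow> (\<lambda>x. cnj (f x)) \<in> borel_measurable M"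
  by (rule borel_measurable_continuous_on[OF continuous_on_cnj[OF continuous_on_id]])

lemma L2_zero: "(\<lambda>x. 0) \<in> L2 M"
  by (auto simp: L2_def)

lemma L2_add:
  assumes "f \<in> L2 M" "g \<in> L2 M"
  shows "(\<lambda>x. f x + g x) \<in> L2 M"
proof (rule L2I)
  have [measurable]: "f \<in> borel_measurable M" "g \<in> borel_measurable M"
    using assms by (auto intro: L2_measurable)
  show "(\<lambda>x. f x + g x) \<in> borel_measurable M" by measurable
  show "integrable M (\<lambda>x. (cmod (f x + g x))\<^sup>2)"
  proof (rule Bochner_Integration.integrable_bound)
    show "integrable M (\<lambda>x. 2 * (cmod (f x))\<^sup>2 + 2 * (cmod (g x))\<^sup>2)"
      using assms by (intro Bochner_Integration.integrable_add integrable_mult_right L2_integrable_norm)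
    show "AE x in M. norm ((cmod (f x + g x))\<^sup>2) \<le> norm (2 * (cmod (f x))\<^sup>2 + 2 * (cmod (g x))\<^sup>2)"
      using norm_add_sq_le by (auto simp: abs_of_nonneg)
  qed measurable
qed

lemma L2_bounded_mult:
  assumes f: "f \<in> L2 M" and [measurable]: "h \<in> borel_measurable M"
    and B: "\<And>x. x \<in> space M \<Longrightarrow> cmod (h x) \<le> B"
  shows "(\<lambda>x. h x * f x) \<in> L2 M"
proof (rule L2I)
  have [measurable]: "f \<in> borel_measurable M"
    using f by (auto intro: L2_measurable)
  show "(\<lambda>x. h x * f x) \<in> borel_measurable M" by measurable
  show "integrable M (\<lambda>x. (cmod (h x * f x))\<^sup>2)"
  proof (rule Bochner_Integration.integrable_bound)
    show "integrable M (\<lambda>x. B\<^sup>2 * (cmod (f x))\<^sup>2)"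
      using f by (intro integrable_mult_right L2_integrable_norm)
    have "(cmod (h x * f x))\<^sup>2 \<le> B\<^sup>2 * (cmod (f x))\<^sup>2" if "x \<in> space M" for x
      unfolding norm_mult power_mult_distrib using B[OF that]
      by (intro mult_right_mono power_mono) auto
    then show "AE x in M. norm ((cmod (h x * f x))\<^sup>2) \<le> norm (B\<^sup>2 * (cmod (f x))\<^sup>2)"
      by (intro AE_I2) (auto simp: abs_of_nonneg)
  qed measurable
qed

lemma L2_cmult: "f \<in> L2 M \<Longrightarrow> (\<lambda>x. c * f x) \<in> L2 M"
  by (rule L2_bounded_mult[where B = "cmod c"]) auto

lemma L2_diff: "f \<in> L2 M \<Longrightarrow> g \<in> L2 M \<Longrightarrow> (\<lambda>x. f x - g x) \<in> L2 M"
  using L2_add[of f M "\<lambda>x. -1 * g x"] L2_cmult[of g M "-1"] by simp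

lemma L2_sum: "(\<And>i. i \<in> F \<Longrightarrow> f i \<in> L2 M) \<Longrightarrow> (\<lambda>x. \<Sum>i\<in>F. f i x) \<in> L2 M"
  by (induction F rule: infinite_finite_induct) (auto intro: L2_zero L2_add)

lemma integrable_L2_product:
  assumes "f \<in> L2 M" "g \<in> L2 M"
  shows "integrable M (\<lambda>x. f x * cnj (g x))"
proof (rule Bochner_Integration.integrable_bound)
  have [measurable]: "f \<in> borel_measurable M" "g \<in> borel_measurable M"
    using assms by (auto intro: L2_measurable)
  show "(\<lambda>x. f x * cnj (g x)) \<in> borel_measurable M" by measurable
  show "integrable M (\<lambda>x. (cmod (f x))\<^sup>2 + (cmod (g x))\<^sup>2)"
    using assms by (intro Bochner_Integration.integrable_add L2_integrable_norm)
  have "cmod a * cmod b \<le> (cmod a)\<^sup>2 + (cmod b)\<^sup>2" for a b :: complex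
    using sum_squares_bound[of "cmod a" "cmod b"] mult_nonneg_nonneg[OF norm_ge_zero[of a] norm_ge_zero[of b]]
    by linarith
  then show "AE x in M. norm (f x * cnj (g x)) \<le> norm ((cmod (f x))\<^sup>2 + (cmod (g x))\<^sup>2)"
    by (auto simp: norm_mult)
qed

lemma L2_inner_commute: "L2_inner M g f = cnj (L2_inner M f g)"
  unfolding L2_inner_def by (subst Bochner_Integration.integral_cnj[symmetric]) (simp add: mult.commute)

lemma L2_inner_cmult_left: "L2_inner M (\<lambda>x. c * f x) g = c * L2_inner M f g"
  unfolding L2_inner_def by (simp add: mult.assoc)

lemma L2_inner_cmult_right: "L2_inner M f (\<lambda>x. c * g x) = cnj c * L2_inner M f g"
  unfolding L2_inner_def by (simp add: mult.left_commute)

lemma L2_inner_add_left: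
  assumes "f \<in> L2 M" "g \<in> L2 M" "h \<in> L2 M"
  shows "L2_inner M (\<lambda>x. f x + g x) h = L2_inner M f h + L2_inner M g h"
  unfolding L2_inner_def distrib_right using assms
  by (intro Bochner_Integration.integral_add integrable_L2_product)

lemma L2_inner_diff_left:
  assumes "f \<in> L2 M" "g \<in> L2 M" "h \<in> L2 M"
  shows "L2_inner M (\<lambda>x. f x - g x) h = L2_inner M f h - L2_inner M g h"
  unfolding L2_inner_def left_diff_distrib using assms
  by (intro Bochner_Integration.integral_diff integrable_L2_product)

lemma L2_inner_sum_left:
  assumes "\<And>i. i \<in> F \<Longrightarrow> f i \<in> L2 M" "h \<in> L2 M"
  shows "L2_inner M (\<lambda>x. \<Sum>i\<in>F. f i x) h = (\<Sum>i\<in>F. L2_inner M (f i) h)"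
  unfolding L2_inner_def sum_distrib_right using assms
  by (intro Bochner_Integration.integral_sum integrable_L2_product)

lemma L2_inner_diff_right:
  assumes "f \<in> L2 M" "g \<in> L2 M" "h \<in> L2 M"
  shows "L2_inner M h (\<lambda>x. f x - g x) = L2_inner M h f - L2_inner M h g"
  by (subst (1 2 3) L2_inner_commute) (simp add: L2_inner_diff_left assms)

lemma L2_inner_sum_right:
  assumes "\<And>i. i \<in> F \<Longrightarrow> f i \<in> L2 M" "h \<in> L2 M"
  shows "L2_inner M h (\<lambda>x. \<Sum>i\<in>F. f i x) = (\<Sum>i\<in>F. L2_inner M h (f i))"
  by (subst (1 2) L2_inner_commute) (simp add: L2_inner_sum_left assms)

lemma L2_inner_cong_AE:
  assumes "AE x in M. f x = f' x" "AE x in M. g x = g' x"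
    and "f \<in> borel_measurable M" "f' \<in> borel_measurable M"
    and "g \<in> borel_measurable M" "g' \<in> borel_measurable M"
  shows "L2_inner M f g = L2_inner M f' g'"
  unfolding L2_inner_def using assms by (intro integral_cong_AE) auto

lemma L2_norm_squared: "(L2_norm M f)\<^sup>2 = (LINT x|M. (cmod (f x))\<^sup>2)"
  unfolding L2_norm_def by (simp add: Bochner_Integration.integral_nonneg)

lemma L2_norm_nonneg: "0 \<le> L2_norm M f"
  unfolding L2_norm_def by (simp add: Bochner_Integration.integral_nonneg)

lemma L2_inner_self: "L2_inner M f f = complex_of_real ((L2_norm M f)\<^sup>2)"
  unfolding L2_norm_squared L2_inner_def
  by (subst integral_complex_of_real[symmetric]) (simp only: complex_norm_square)

lemma L2_norm_eq_0_imp_AE: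
  assumes "f \<in> L2 M" "L2_norm M f = 0"
  shows "AE x in M. f x = 0"
proof -
  have "(LINT x|M. (cmod (f x))\<^sup>2) = 0"
    using assms L2_norm_squared[of M f] by simp
  then have "AE x in M. (cmod (f x))\<^sup>2 = 0"
    using integral_nonneg_eq_0_iff_AE[OF L2_integrable_norm[OF assms(1)]] by simp
  then show ?thesis by simp
qed

text \<open>
  Obtained from the inequality for nonnegative integrals of the absolute values.
\<close>

lemma L2_Cauchy_Schwarz:
  assumes f: "f \<in> L2 M" and g: "g \<in> L2 M"
  shows "cmod (L2_inner M f g) \<le> L2_norm M f * L2_norm M g"
proof -
  have [measurable]: "f \<in> borel_measurable M" "g \<in> borel_measurable M"
    using assms by (auto intro: L2_measurable)
  have int: "integrable M (\<lambda>x. cmod (f x) * cmod (g x))"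
    using integrable_norm[OF integrable_L2_product[OF f g]] by (simp add: norm_mult)
  let ?I = "LINT x|M. cmod (f x) * cmod (g x)"
  have sq: "(\<integral>\<^sup>+x. (ennreal (cmod (h x)))\<^sup>2 \<partial>M) = ennreal ((L2_norm M h)\<^sup>2)" if "h \<in> L2 M" for h
    unfolding L2_norm_squared
    by (subst nn_integral_eq_integral[OF L2_integrable_norm[OF that], symmetric]) (auto simp: ennreal_power)
  have "ennreal (?I\<^sup>2) = (\<integral>\<^sup>+x. ennreal (cmod (f x)) * ennreal (cmod (g x)) \<partial>M)\<^sup>2"
    using nn_integral_eq_integral[OF int]
    by (simp add: ennreal_mult ennreal_power Bochner_Integration.integral_nonneg)
  also have "\<dots> \<le> (\<integral>\<^sup>+x. (ennreal (cmod (f x)))\<^sup>2 \<partial>M) * (\<integral>\<^sup>+x. (ennreal (cmod (g x)))\<^sup>2 \<partial>M)"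
    by (rule Cauchy_Schwarz_nn_integral) measurable
  also have "\<dots> = ennreal ((L2_norm M f * L2_norm M g)\<^sup>2)"
    by (simp add: sq f g ennreal_mult power_mult_distrib)
  finally have "?I\<^sup>2 \<le> (L2_norm M f * L2_norm M g)\<^sup>2"
    by simp
  then have "?I \<le> L2_norm M f * L2_norm M g"
    by (rule power2_le_imp_le) (simp add: L2_norm_nonneg)
  moreover have "cmod (L2_inner M f g) \<le> ?I"
    unfolding L2_inner_def using integral_norm_bound[of M "\<lambda>x. f x * cnj (g x)"] by (simp add: norm_mult)
  ultimately show ?thesis by simp
qed

text \<open>
  Unconditional norm convergence implies weak convergence.  This is what makes expansions
  computable: the coefficients of a sum are the sums of the coefficients, and a sum is determined
  up to a null set.
\<close>

lemma L2_has_sum_inner: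
  assumes sum: "L2_has_sum M f K s" and h: "h \<in> L2 M"
  shows "((\<lambda>i. L2_inner M (f i) h) has_sum L2_inner M s h) K"
  unfolding has_sum_def
proof (rule Lim_null_comparison[THEN Lim_null[THEN iffD2]])
  have s: "s \<in> L2 M" and f: "\<And>k. k \<in> K \<Longrightarrow> f k \<in> L2 M"
    and lim: "((\<lambda>F. L2_norm M (\<lambda>x. s x - (\<Sum>k\<in>F. f k x))) \<longlongrightarrow> 0) (finite_subsets_at_top K)"
    using sum by (auto simp: L2_has_sum_def)
  show "((\<lambda>F. L2_norm M (\<lambda>x. s x - (\<Sum>k\<in>F. f k x)) * L2_norm M h) \<longlongrightarrow> 0) (finite_subsets_at_top K)"
    using tendsto_mult_right[OF lim, of "L2_norm M h"] by simp
  show "\<forall>\<^sub>F F in finite_subsets_at_top K. norm ((\<Sum>i\<in>F. L2_inner M (f i) h) - L2_inner M s h)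
          \<le> L2_norm M (\<lambda>x. s x - (\<Sum>k\<in>F. f k x)) * L2_norm M h"
  proof (rule eventually_finite_subsets_at_top_weakI)
    fix F assume F: "finite F" "F \<subseteq> K"
    then have fF: "\<And>i. i \<in> F \<Longrightarrow> f i \<in> L2 M"
      using f by auto
    have "L2_inner M s h - (\<Sum>i\<in>F. L2_inner M (f i) h) = L2_inner M (\<lambda>x. s x - (\<Sum>k\<in>F. f k x)) h"
      by (simp add: L2_inner_diff_left L2_inner_sum_left L2_sum s h fF)
    then show "norm ((\<Sum>i\<in>F. L2_inner M (f i) h) - L2_inner M s h)
        \<le> L2_norm M (\<lambda>x. s x - (\<Sum>k\<in>F. f k x)) * L2_norm M h"
      using L2_Cauchy_Schwarz[OF L2_diff[OF s L2_sum[OF fF]] h, of F]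
      by (simp add: norm_minus_commute)
  qed
qed

section \<open>Frames whose frame operator is a multiplication operator\<close>

lemma polarization:
  "4 * (a * cnj b) = complex_of_real ((cmod (a + b))\<^sup>2) - complex_of_real ((cmod (a - b))\<^sup>2)
     + \<i> * complex_of_real ((cmod (a + \<i> * b))\<^sup>2) - \<i> * complex_of_real ((cmod (a - \<i> * b))\<^sup>2)"
  unfolding cmod_power2 by (simp add: complex_eq_iff power2_eq_square algebra_simps)

text \<open>
  The hypothesis says that \<open>S = F\<^sup>* F\<close> has the quadratic form of multiplication by \<open>N\<close>.  The
  bounds \<open>1\<close> and \<open>C\<close> on \<open>N\<close> are then frame bounds.
\<close>

locale multiplier_frame =
  fixes M :: "'a measure" and K :: "'k set" and e :: "'k \<Rightarrow> 'a \<Rightarrow> complex"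
    and N :: "'a \<Rightarrow> real" and C :: real
  assumes e_L2: "k \<in> K \<Longrightarrow> e k \<in> L2 M"
    and N_measurable [measurable]: "N \<in> borel_measurable M"
    and N_ge_1: "x \<in> space M \<Longrightarrow> 1 \<le> N x"
    and N_le: "x \<in> space M \<Longrightarrow> N x \<le> C"
    and weighted_Parseval: "f \<in> L2 M \<Longrightarrow>
      ((\<lambda>k. (cmod (L2_inner M f (e k)))\<^sup>2) has_sum (LINT x|M. N x * (cmod (f x))\<^sup>2)) K"
begin

lemma L2_times_N: "f \<in> L2 M \<Longrightarrow> (\<lambda>x. complex_of_real (N x) * f x) \<in> L2 M"
  using N_ge_1 N_le by (intro L2_bounded_mult[where B = C]) (force simp: abs_if)+

lemma L2_over_N: "f \<in> L2 M \<Longrightarrow> (\<lambda>x. complex_of_real (inverse (N x)) * f x) \<in> L2 M"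
proof (rule L2_bounded_mult[where B = 1])
  show "cmod (complex_of_real (inverse (N x))) \<le> 1" if "x \<in> space M" for x
    using N_ge_1[OF that] by (auto simp: norm_inverse norm_of_real intro: inverse_le_1_iff[THEN iffD2])
qed auto

lemma times_over_N: "x \<in> space M \<Longrightarrow> complex_of_real (N x) * (complex_of_real (inverse (N x)) * c) = c"
  using N_ge_1[of x] by simp

text \<open>
  Both sides are sesquilinear in \<open>(f, h)\<close> and agree on the diagonal, so the polarization identity,
  applied to the coefficients on one side and to the values on the other, extends the weighted
  Parseval identity to pairs.
\<close>

lemma polarized_Parseval:
  assumes f: "f \<in> L2 M" and h: "h \<in> L2 M"
  shows "((\<lambda>k. L2_inner M f (e k) * cnj (L2_inner M h (e k))) has_sum
     L2_inner M f (\<lambda>x. complex_of_real (N x) * h x)) K"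
proof -
  have quarter: "z = inverse 4 * z'" if "4 * z = z'" for z z' :: complex
    using that by auto
  \<comment> \<open>the instances \<open>c = 1, -1, \<i>, -\<i>\<close> are the four terms of the polarization identity\<close>
  define Q where "Q c = (\<lambda>x. f x + c * h x)" for c
  have Q: "Q c \<in> L2 M" for c
    unfolding Q_def by (intro L2_add L2_cmult f h)
  have inner_Q: "L2_inner M (Q c) (e k) = L2_inner M f (e k) + c * L2_inner M h (e k)" if "k \<in> K" for c k
    unfolding Q_def using e_L2[OF that] by (simp add: L2_inner_add_left L2_inner_cmult_left L2_cmult f h)
  have sumQ: "((\<lambda>k. complex_of_real ((cmod (L2_inner M f (e k) + c * L2_inner M h (e k)))\<^sup>2))
      has_sum complex_of_real (LINT x|M. N x * (cmod (Q c x))\<^sup>2)) K" for c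
    using has_sum_of_real[OF weighted_Parseval[OF Q[of c]]]
    by (rule has_sum_cong[THEN iffD1, rotated]) (simp add: inner_Q)
  have int: "integrable M (\<lambda>x. N x * (cmod (Q c x))\<^sup>2)" for c
  proof (rule Bochner_Integration.integrable_bound)
    show "integrable M (\<lambda>x. C * (cmod (Q c x))\<^sup>2)"
      by (intro integrable_mult_right L2_integrable_norm Q)
    show "AE x in M. norm (N x * (cmod (Q c x))\<^sup>2) \<le> norm (C * (cmod (Q c x))\<^sup>2)"
      using N_ge_1 N_le by (intro AE_I2) (force simp: abs_mult intro!: mult_right_mono)
  qed (use L2_measurable[OF Q] in measurable)
  have int': "integrable M (\<lambda>x. complex_of_real (N x * (cmod (Q c x))\<^sup>2))" for c
    by (rule integrable_of_real[OF int])
  have eq: "complex_of_real (LINT x|M. N x * (cmod (Q c x))\<^sup>2) =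
      (LINT x|M. complex_of_real (N x * (cmod (Q c x))\<^sup>2))" for c
    by (rule integral_complex_of_real[symmetric])
  have "4 * L2_inner M f (\<lambda>x. complex_of_real (N x) * h x) =
      (LINT x|M. complex_of_real (N x * (cmod (Q 1 x))\<^sup>2) - complex_of_real (N x * (cmod (Q (-1) x))\<^sup>2)
        + \<i> * complex_of_real (N x * (cmod (Q \<i> x))\<^sup>2) - \<i> * complex_of_real (N x * (cmod (Q (-\<i>) x))\<^sup>2))"
  proof -
    have pt: "4 * (f x * cnj (complex_of_real (N x) * h x)) =
       complex_of_real (N x * (cmod (Q 1 x))\<^sup>2) - complex_of_real (N x * (cmod (Q (-1) x))\<^sup>2)
        + \<i> * complex_of_real (N x * (cmod (Q \<i> x))\<^sup>2) - \<i> * complex_of_real (N x * (cmod (Q (-\<i>) x))\<^sup>2)" for x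
    proof -
      have "4 * (f x * cnj (complex_of_real (N x) * h x)) = complex_of_real (N x) * (4 * (f x * cnj (h x)))"
        by simp
      also have "\<dots> = complex_of_real (N x) * (complex_of_real ((cmod (Q 1 x))\<^sup>2) - complex_of_real ((cmod (Q (-1) x))\<^sup>2)
        + \<i> * complex_of_real ((cmod (Q \<i> x))\<^sup>2) - \<i> * complex_of_real ((cmod (Q (-\<i>) x))\<^sup>2))"
        unfolding polarization Q_def by simp
      finally show ?thesis by (simp add: algebra_simps)
    qed
    show ?thesis
      unfolding L2_inner_def pt[symmetric] by simp
  qed
  also have "\<dots> = complex_of_real (LINT x|M. N x * (cmod (Q 1 x))\<^sup>2) - complex_of_real (LINT x|M. N x * (cmod (Q (-1) x))\<^sup>2)
        + \<i> * complex_of_real (LINT x|M. N x * (cmod (Q \<i> x))\<^sup>2) - \<i> * complex_of_real (LINT x|M. N x * (cmod (Q (-\<i>) x))\<^sup>2)"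
    unfolding eq using int'
    by (simp del: of_real_mult of_real_power integral_complex_of_real
        add: Bochner_Integration.integral_add Bochner_Integration.integral_diff)
  finally have total: "L2_inner M f (\<lambda>x. complex_of_real (N x) * h x) = inverse 4 *
     (complex_of_real (LINT x|M. N x * (cmod (Q 1 x))\<^sup>2) - complex_of_real (LINT x|M. N x * (cmod (Q (-1) x))\<^sup>2)
        + \<i> * complex_of_real (LINT x|M. N x * (cmod (Q \<i> x))\<^sup>2) - \<i> * complex_of_real (LINT x|M. N x * (cmod (Q (-\<i>) x))\<^sup>2))"
    by (rule quarter)
  have diff: "((\<lambda>k. F k - G k) has_sum (a - b)) K"
    if "(F has_sum a) K" "(G has_sum b) K" for F G :: "'k \<Rightarrow> complex" and a b
    using has_sum_add[OF that(1) has_sum_uminusI[OF that(2)]] by simp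
  have "((\<lambda>k. inverse 4 * (complex_of_real ((cmod (L2_inner M f (e k) + 1 * L2_inner M h (e k)))\<^sup>2)
          - complex_of_real ((cmod (L2_inner M f (e k) + (-1) * L2_inner M h (e k)))\<^sup>2)
          + \<i> * complex_of_real ((cmod (L2_inner M f (e k) + \<i> * L2_inner M h (e k)))\<^sup>2)
          - \<i> * complex_of_real ((cmod (L2_inner M f (e k) + (-\<i>) * L2_inner M h (e k)))\<^sup>2))) has_sum
     inverse 4 * (complex_of_real (LINT x|M. N x * (cmod (Q 1 x))\<^sup>2) - complex_of_real (LINT x|M. N x * (cmod (Q (-1) x))\<^sup>2)
        + \<i> * complex_of_real (LINT x|M. N x * (cmod (Q \<i> x))\<^sup>2) - \<i> * complex_of_real (LINT x|M. N x * (cmod (Q (-\<i>) x))\<^sup>2))) K"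
    by (intro has_sum_cmult_right has_sum_add diff sumQ)
  moreover have "L2_inner M f (e k) * cnj (L2_inner M h (e k)) =
      inverse 4 * (complex_of_real ((cmod (L2_inner M f (e k) + 1 * L2_inner M h (e k)))\<^sup>2)
          - complex_of_real ((cmod (L2_inner M f (e k) + (-1) * L2_inner M h (e k)))\<^sup>2)
          + \<i> * complex_of_real ((cmod (L2_inner M f (e k) + \<i> * L2_inner M h (e k)))\<^sup>2)
          - \<i> * complex_of_real ((cmod (L2_inner M f (e k) + (-\<i>) * L2_inner M h (e k)))\<^sup>2))" for k
    by (rule quarter) (use polarization[of "L2_inner M f (e k)" "L2_inner M h (e k)"] in simp)
  ultimately show ?thesis
    unfolding total by (simp only:)
qed

text \<open>
  Multiplication by \<open>N\<close> meets the specification of \<open>S\<close> by the polarized identity; two functions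
  meeting it have the same inner products with their difference.
\<close>

lemma frame_S_eq:
  assumes f: "f \<in> L2 M"
  shows "frame_S M K e f \<in> L2 M" "AE x in M. frame_S M K e f x = complex_of_real (N x) * f x"
proof -
  let ?Nf = "\<lambda>x. complex_of_real (N x) * f x"
  let ?P = "\<lambda>g. g \<in> L2 M \<and> (\<forall>f'\<in>L2 M. ell2_inner K (frame_op M K e f') (frame_op M K e f) = L2_inner M f' g)"
  have val: "ell2_inner K (frame_op M K e f') (frame_op M K e f) = L2_inner M f' ?Nf" if "f' \<in> L2 M" for f'
  proof -
    have "ell2_inner K (frame_op M K e f') (frame_op M K e f) =
        (\<Sum>\<^sub>\<infinity>k\<in>K. L2_inner M f' (e k) * cnj (L2_inner M f (e k)))"
      unfolding ell2_inner_def frame_op_def by (rule infsum_cong) simp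
    then show ?thesis
      using infsumI[OF polarized_Parseval[OF that f]] by simp
  qed
  have "?P ?Nf"
    using val L2_times_N[OF f] by blast
  then have g: "?P (frame_S M K e f)"
    unfolding frame_S_def frame_adj_def by (rule someI[of ?P])
  then show *: "frame_S M K e f \<in> L2 M" by blast
  let ?d = "\<lambda>x. frame_S M K e f x - ?Nf x"
  have d: "?d \<in> L2 M"
    by (intro L2_diff * L2_times_N f)
  have "L2_inner M ?d ?d = L2_inner M ?d (frame_S M K e f) - L2_inner M ?d ?Nf"
    by (intro L2_inner_diff_right * L2_times_N f d)
  also have "\<dots> = 0"
    using g val d by (metis (no_types, lifting) right_minus_eq)
  finally have "L2_norm M ?d = 0"
    unfolding L2_inner_self by simp
  then show "AE x in M. frame_S M K e f x = ?Nf x"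
    using L2_norm_eq_0_imp_AE[OF d] by simp
qed

lemma dual_frame_eq:
  assumes k: "k \<in> K"
  shows "dual_frame M K e k \<in> L2 M"
    "AE x in M. dual_frame M K e k x = complex_of_real (inverse (N x)) * e k x"
proof -
  let ?g = "\<lambda>x. complex_of_real (inverse (N x)) * e k x"
  let ?P = "\<lambda>g. g \<in> L2 M \<and> L2_eq M (frame_S M K e g) (e k)"
  have g: "?g \<in> L2 M"
    by (rule L2_over_N[OF e_L2[OF k]])
  have "AE x in M. frame_S M K e ?g x = e k x"
    using frame_S_eq(2)[OF g] AE_space[of M] by eventually_elim (simp only: times_over_N)
  then have "?P ?g"
    using g by (simp add: L2_eq_def)
  then have P: "?P (dual_frame M K e k)"
    unfolding dual_frame_def by (rule someI[of ?P])
  then show *: "dual_frame M K e k \<in> L2 M" by blast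
  have "AE x in M. frame_S M K e (dual_frame M K e k) x = e k x"
    using P by (simp add: L2_eq_def)
  with frame_S_eq(2)[OF *] AE_space[of M] show "AE x in M. dual_frame M K e k x = ?g x"
  proof eventually_elim
    case (elim x)
    then have "complex_of_real (N x) * dual_frame M K e k x = e k x" by simp
    moreover have "N x \<noteq> 0" using N_ge_1[OF elim(2)] by simp
    ultimately show ?case by (simp add: field_simps)
  qed
qed

lemma L2_inner_dual_left:
  assumes k: "k \<in> K" and h: "h \<in> L2 M"
  shows "L2_inner M (dual_frame M K e k) h =
    cnj (L2_inner M (\<lambda>x. complex_of_real (inverse (N x)) * h x) (e k))"
proof -
  have "L2_inner M (dual_frame M K e k) h = L2_inner M (\<lambda>x. complex_of_real (inverse (N x)) * e k x) h"
    using dual_frame_eq[OF k] L2_over_N[OF e_L2[OF k]] h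
    by (intro L2_inner_cong_AE) (auto intro: L2_measurable)
  also have "\<dots> = L2_inner M (e k) (\<lambda>x. complex_of_real (inverse (N x)) * h x)"
    unfolding L2_inner_def by (simp add: mult_ac)
  also have "\<dots> = cnj (L2_inner M (\<lambda>x. complex_of_real (inverse (N x)) * h x) (e k))"
    by (rule L2_inner_commute)
  finally show ?thesis .
qed

text \<open>
  The reconstruction formula.  Let \<open>r\<close> be the remainder after a finite partial sum over \<open>F\<close>.  Since
  \<open>\<langle>S\<^sup>-\<^sup>1 e\<^sub>k, r\<rangle>\<close> is the conjugate of the coefficient \<open>b\<^sub>k\<close> of \<open>r / N\<close>, the polarized identity turns
  \<open>\<langle>r, r\<rangle>\<close> into the sum of \<open>a\<^sub>k\<close> times the conjugate of \<open>b\<^sub>k\<close> over the indices outside \<open>F\<close>.  The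
  energy of \<open>b\<close> is \<open>\<integral> |r|\<^sup>2 / N \<le> \<parallel>r\<parallel>\<^sup>2\<close>, so Cauchy-Schwarz bounds \<open>\<parallel>r\<parallel>\<^sup>2\<close> by the energy of \<open>a\<close>
  outside \<open>F\<close>, which tends to \<open>0\<close>.
\<close>

lemma dual_expansion:
  assumes f: "f \<in> L2 M"
  shows "L2_has_sum M (\<lambda>k x. L2_inner M f (e k) * dual_frame M K e k x) K f"
  unfolding L2_has_sum_def
proof (intro conjI ballI f)
  define a where "a k = L2_inner M f (e k)" for k
  define A where "A = (LINT x|M. N x * (cmod (f x))\<^sup>2)"
  define r where "r F = (\<lambda>x. f x - (\<Sum>k\<in>F. a k * dual_frame M K e k x))" for F
  have sum_a: "((\<lambda>k. (cmod (a k))\<^sup>2) has_sum A) K"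
    unfolding a_def A_def by (rule weighted_Parseval[OF f])
  have dual: "(\<lambda>x. a k * dual_frame M K e k x) \<in> L2 M" if "k \<in> K" for k
    using L2_cmult dual_frame_eq(1)[OF that] by blast
  then show "\<And>k. k \<in> K \<Longrightarrow> (\<lambda>x. L2_inner M f (e k) * dual_frame M K e k x) \<in> L2 M"
    unfolding a_def .
  have bound: "(L2_norm M (r F))\<^sup>2 \<le> A - (\<Sum>k\<in>F. (cmod (a k))\<^sup>2)" if F: "finite F" "F \<subseteq> K" for F
  proof -
    let ?rN = "\<lambda>x. complex_of_real (inverse (N x)) * r F x"
    define b where "b k = L2_inner M ?rN (e k)" for k
    define t where "t = A - (\<Sum>k\<in>F. (cmod (a k))\<^sup>2)"
    have r: "r F \<in> L2 M"
      unfolding r_def using F dual by (intro L2_diff f L2_sum) auto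
    have rN: "?rN \<in> L2 M"
      by (rule L2_over_N[OF r])
    have "L2_inner M f (\<lambda>x. complex_of_real (N x) * ?rN x) = L2_inner M f (r F)"
      unfolding L2_inner_def using times_over_N by (intro Bochner_Integration.integral_cong) auto
    then have ab: "((\<lambda>k. a k * cnj (b k)) has_sum L2_inner M f (r F)) K"
      using polarized_Parseval[OF f rN] unfolding a_def b_def by simp
    have "L2_inner M (r F) (r F) = L2_inner M f (r F) - (\<Sum>k\<in>F. a k * cnj (b k))"
    proof -
      have "L2_inner M (r F) (r F) = L2_inner M f (r F)
          - (\<Sum>k\<in>F. L2_inner M (\<lambda>x. a k * dual_frame M K e k x) (r F))"
        by (subst (1) r_def, subst L2_inner_diff_left, use F dual in
            \<open>auto intro!: f L2_sum r L2_inner_sum_left\<close>)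
      also have "(\<Sum>k\<in>F. L2_inner M (\<lambda>x. a k * dual_frame M K e k x) (r F)) = (\<Sum>k\<in>F. a k * cnj (b k))"
        using F by (intro sum.cong refl) (auto simp: L2_inner_cmult_left L2_inner_dual_left r b_def)
      finally show ?thesis .
    qed
    then have lim: "((\<lambda>E. (\<Sum>k\<in>E. a k * cnj (b k)) - (\<Sum>k\<in>F. a k * cnj (b k))) \<longlongrightarrow> L2_inner M (r F) (r F))
        (finite_subsets_at_top K)"
      using ab unfolding has_sum_def by (auto intro!: tendsto_intros)
    have B: "((\<lambda>k. (cmod (b k))\<^sup>2) has_sum (LINT x|M. N x * (cmod (?rN x))\<^sup>2)) K"
      unfolding b_def by (rule weighted_Parseval[OF rN])
    have B_le: "(LINT x|M. N x * (cmod (?rN x))\<^sup>2) \<le> (L2_norm M (r F))\<^sup>2"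
      unfolding L2_norm_squared
    proof (rule integral_mono')
      show "integrable M (\<lambda>x. (cmod (r F x))\<^sup>2)" by (rule L2_integrable_norm[OF r])
      fix x assume "x \<in> space M"
      then have N: "1 \<le> N x" by (rule N_ge_1)
      have "N x * (cmod (?rN x))\<^sup>2 = inverse (N x) * (cmod (r F x))\<^sup>2"
        using N by (simp add: norm_mult norm_inverse power_mult_distrib power2_eq_square)
      also have "\<dots> \<le> 1 * (cmod (r F x))\<^sup>2"
        using N by (intro mult_right_mono) (auto simp: inverse_le_1_iff)
      finally show "N x * (cmod (?rN x))\<^sup>2 \<le> (cmod (r F x))\<^sup>2" by simp
    qed auto
    have "cmod (L2_inner M (r F) (r F)) \<le> sqrt t * L2_norm M (r F)"
    proof (rule tendsto_upperbound[OF tendsto_norm[OF lim]])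
      show "\<forall>\<^sub>F E in finite_subsets_at_top K.
          cmod ((\<Sum>k\<in>E. a k * cnj (b k)) - (\<Sum>k\<in>F. a k * cnj (b k))) \<le> sqrt t * L2_norm M (r F)"
        unfolding eventually_finite_subsets_at_top
      proof (intro exI[of _ F] conjI allI impI F)
        fix E assume E: "finite E \<and> F \<subseteq> E \<and> E \<subseteq> K"
        have "(\<Sum>k\<in>E. a k * cnj (b k)) - (\<Sum>k\<in>F. a k * cnj (b k)) = (\<Sum>k\<in>E - F. a k * cnj (b k))"
          using E F by (simp add: sum_diff)
        also have "cmod \<dots> \<le> (\<Sum>k\<in>E - F. \<bar>cmod (a k)\<bar> * \<bar>cmod (b k)\<bar>)"
          by (rule norm_sum[THEN order_trans]) (simp add: norm_mult)
        also have "\<dots> \<le> L2_set (\<lambda>k. cmod (a k)) (E - F) * L2_set (\<lambda>k. cmod (b k)) (E - F)"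
          by (rule L2_set_mult_ineq)
        also have "\<dots> \<le> sqrt t * L2_norm M (r F)"
        proof (rule mult_mono)
          have "(\<Sum>k\<in>E. (cmod (a k))\<^sup>2) \<le> A"
            using E by (intro finite_sum_le_has_sum[OF sum_a]) auto
          then show "L2_set (\<lambda>k. cmod (a k)) (E - F) \<le> sqrt t"
            unfolding L2_set_def t_def using E F by (simp add: sum_diff)
          have "(\<Sum>k\<in>E - F. (cmod (b k))\<^sup>2) \<le> (L2_norm M (r F))\<^sup>2"
            using E by (intro order_trans[OF finite_sum_le_has_sum[OF B] B_le]) auto
          then show "L2_set (\<lambda>k. cmod (b k)) (E - F) \<le> L2_norm M (r F)"
            unfolding L2_set_def by (intro real_le_lsqrt) (auto simp: L2_norm_nonneg sum_nonneg)
          have "(\<Sum>k\<in>F. (cmod (a k))\<^sup>2) \<le> A"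
            using F by (intro finite_sum_le_has_sum[OF sum_a]) auto
          then show "0 \<le> sqrt t" by (simp add: t_def)
        qed simp
        finally show "cmod ((\<Sum>k\<in>E. a k * cnj (b k)) - (\<Sum>k\<in>F. a k * cnj (b k))) \<le> sqrt t * L2_norm M (r F)" .
      qed
    qed simp
    then have le: "L2_norm M (r F) * L2_norm M (r F) \<le> sqrt t * L2_norm M (r F)"
      unfolding L2_inner_self by (simp add: norm_power power2_eq_square norm_mult L2_norm_nonneg)
    have t0: "0 \<le> t"
      unfolding t_def using F finite_sum_le_has_sum[OF sum_a, of F] by simp
    have "L2_norm M (r F) \<le> sqrt t"
      using le L2_norm_nonneg[of M "r F"] t0 by (cases "L2_norm M (r F) = 0") (auto simp: mult_le_cancel_right)
    then have "(L2_norm M (r F))\<^sup>2 \<le> (sqrt t)\<^sup>2"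
      by (intro power_mono) (auto simp: L2_norm_nonneg)
    then show ?thesis using t0 by (simp add: t_def)
  qed
  have "((\<lambda>F. A - (\<Sum>k\<in>F. (cmod (a k))\<^sup>2)) \<longlongrightarrow> A - A) (finite_subsets_at_top K)"
    using sum_a unfolding has_sum_def by (intro tendsto_intros)
  then have lim_tail: "((\<lambda>F. A - (\<Sum>k\<in>F. (cmod (a k))\<^sup>2)) \<longlongrightarrow> 0) (finite_subsets_at_top K)"
    by simp
  have "((\<lambda>F. (L2_norm M (r F))\<^sup>2) \<longlongrightarrow> 0) (finite_subsets_at_top K)"
  proof (rule tendsto_sandwich[OF _ _ tendsto_const lim_tail])
    show "\<forall>\<^sub>F F in finite_subsets_at_top K. 0 \<le> (L2_norm M (r F))\<^sup>2"
      by simp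
    show "\<forall>\<^sub>F F in finite_subsets_at_top K. (L2_norm M (r F))\<^sup>2 \<le> A - (\<Sum>k\<in>F. (cmod (a k))\<^sup>2)"
      by (rule eventually_finite_subsets_at_top_weakI) (rule bound)
  qed
  then have "((\<lambda>F. sqrt ((L2_norm M (r F))\<^sup>2)) \<longlongrightarrow> sqrt 0) (finite_subsets_at_top K)"
    by (rule tendsto_real_sqrt)
  then show "((\<lambda>F. L2_norm M (\<lambda>x. f x - (\<Sum>k\<in>F. L2_inner M f (e k) * dual_frame M K e k x))) \<longlongrightarrow> 0)
      (finite_subsets_at_top K)"
    by (simp add: L2_norm_nonneg r_def a_def)
qed

text \<open>
  Pairing the expansion of \<open>f\<close> with \<open>N f\<close> shows that \<open>b\<close> and the frame coefficients of \<open>f\<close> have the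
  same inner product with the latter; so \<open>b - F f\<close> is orthogonal to \<open>F f\<close>, and Pythagoras applies.
\<close>

lemma dual_expansion_energy:
  assumes f: "f \<in> L2 M"
    and b: "(\<lambda>k. (cmod (b k))\<^sup>2) summable_on K"
    and sum: "L2_has_sum M (\<lambda>k x. b k * dual_frame M K e k x) K f"
  shows "(\<Sum>\<^sub>\<infinity>k\<in>K. (cmod (b k))\<^sup>2) = (\<Sum>\<^sub>\<infinity>k\<in>K. (cmod (L2_inner M f (e k)))\<^sup>2)
     + (\<Sum>\<^sub>\<infinity>k\<in>K. (cmod (b k - L2_inner M f (e k)))\<^sup>2)"
    "(\<lambda>k. (cmod (b k - L2_inner M f (e k)))\<^sup>2) summable_on K"
proof -
  define a where "a k = L2_inner M f (e k)" for k
  let ?Nf = "\<lambda>x. complex_of_real (N x) * f x"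
  have Nf: "?Nf \<in> L2 M" by (rule L2_times_N[OF f])
  have dual_Nf: "L2_inner M (dual_frame M K e k) ?Nf = cnj (a k)" if "k \<in> K" for k
  proof -
    have "L2_inner M (\<lambda>x. complex_of_real (inverse (N x)) * ?Nf x) (e k) = a k"
      unfolding L2_inner_def a_def using times_over_N
      by (intro Bochner_Integration.integral_cong) (auto simp: mult.left_commute)
    then show ?thesis using L2_inner_dual_left[OF that Nf] by simp
  qed
  have "((\<lambda>k. b k * L2_inner M (dual_frame M K e k) ?Nf) has_sum L2_inner M f ?Nf) K"
    using L2_has_sum_inner[OF sum Nf] by (simp add: L2_inner_cmult_left)
  then have ba: "((\<lambda>k. b k * cnj (a k)) has_sum L2_inner M f ?Nf) K"
    using dual_Nf by (subst has_sum_cong[symmetric]) auto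
  have aa: "((\<lambda>k. a k * cnj (a k)) has_sum L2_inner M f ?Nf) K"
    unfolding a_def by (rule polarized_Parseval[OF f f])
  have "((\<lambda>k. b k * cnj (a k) - a k * cnj (a k)) has_sum 0) K"
    using has_sum_add[OF ba has_sum_uminusI[OF aa]] by simp
  from has_sum_Re[OF this]
  have cross: "((\<lambda>k. Re (b k * cnj (a k) - a k * cnj (a k))) has_sum 0) K" by simp
  have sa: "((\<lambda>k. (cmod (a k))\<^sup>2) has_sum (\<Sum>\<^sub>\<infinity>k\<in>K. (cmod (a k))\<^sup>2)) K"
    using weighted_Parseval[OF f] unfolding a_def by (simp add: has_sum_iff)
  have sb: "((\<lambda>k. (cmod (b k))\<^sup>2) has_sum (\<Sum>\<^sub>\<infinity>k\<in>K. (cmod (b k))\<^sup>2)) K"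
    using b by simp
  have "((\<lambda>k. (cmod (b k))\<^sup>2 + - (cmod (a k))\<^sup>2 + - (2 * Re (b k * cnj (a k) - a k * cnj (a k)))) has_sum
      ((\<Sum>\<^sub>\<infinity>k\<in>K. (cmod (b k))\<^sup>2) + - (\<Sum>\<^sub>\<infinity>k\<in>K. (cmod (a k))\<^sup>2) + - (2 * 0))) K"
    by (intro has_sum_add has_sum_uminusI has_sum_cmult_right sa sb cross)
  moreover have "(cmod (b k))\<^sup>2 + - (cmod (a k))\<^sup>2 + - (2 * Re (b k * cnj (a k) - a k * cnj (a k)))
      = (cmod (b k - a k))\<^sup>2" for k
    unfolding cmod_power2 by (simp add: power2_eq_square algebra_simps)
  ultimately have "((\<lambda>k. (cmod (b k - a k))\<^sup>2) has_sum
      ((\<Sum>\<^sub>\<infinity>k\<in>K. (cmod (b k))\<^sup>2) - (\<Sum>\<^sub>\<infinity>k\<in>K. (cmod (a k))\<^sup>2))) K"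
    by simp
  then show "(\<Sum>\<^sub>\<infinity>k\<in>K. (cmod (b k))\<^sup>2) = (\<Sum>\<^sub>\<infinity>k\<in>K. (cmod (L2_inner M f (e k)))\<^sup>2)
     + (\<Sum>\<^sub>\<infinity>k\<in>K. (cmod (b k - L2_inner M f (e k)))\<^sup>2)"
    "(\<lambda>k. (cmod (b k - L2_inner M f (e k)))\<^sup>2) summable_on K"
    unfolding a_def by (auto simp: has_sum_iff)
qed

end

section \<open>Totality of the exponentials on a square\<close>

text \<open>
  The distance of \<open>f\<close> to a linear combination of orthonormal functions, which is least for the
  Fourier coefficients.  The case \<open>a i = \<langle>f, e i\<rangle>\<close> is Bessel's inequality.
\<close>

lemma L2_orthonormal_distance:
  assumes F: "finite F" and e: "\<And>i. i \<in> F \<Longrightarrow> e i \<in> L2 M" and f: "f \<in> L2 M"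
    and orth: "\<And>i j. i \<in> F \<Longrightarrow> j \<in> F \<Longrightarrow> L2_inner M (e i) (e j) = (if i = j then 1 else 0)"
  shows "(L2_norm M (\<lambda>x. f x - (\<Sum>i\<in>F. a i * e i x)))\<^sup>2 =
    (L2_norm M f)\<^sup>2 - (\<Sum>i\<in>F. (cmod (L2_inner M f (e i)))\<^sup>2) + (\<Sum>i\<in>F. (cmod (L2_inner M f (e i) - a i))\<^sup>2)"
proof -
  define c where "c i = L2_inner M f (e i)" for i
  let ?p = "\<lambda>x. \<Sum>i\<in>F. a i * e i x"
  have ae: "(\<lambda>x. a i * e i x) \<in> L2 M" if "i \<in> F" for i
    using L2_cmult e[OF that] by blast
  have p: "?p \<in> L2 M"
    using ae by (rule L2_sum)
  have fp: "L2_inner M f ?p = (\<Sum>i\<in>F. cnj (a i) * c i)"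
    by (simp add: L2_inner_sum_right ae f L2_inner_cmult_right c_def)
  then have pf: "L2_inner M ?p f = (\<Sum>i\<in>F. a i * cnj (c i))"
    by (subst L2_inner_commute) (simp add: cnj_sum)
  have "L2_inner M ?p ?p = (\<Sum>i\<in>F. a i * (\<Sum>j\<in>F. cnj (a j) * L2_inner M (e i) (e j)))"
    using p by (simp add: L2_inner_sum_left L2_inner_sum_right ae e L2_inner_cmult_left L2_inner_cmult_right)
  also have "\<dots> = (\<Sum>i\<in>F. a i * cnj (a i))"
    using F by (intro sum.cong refl) (simp add: orth if_distrib if_distribR sum.delta' cong: if_cong)
  finally have pp: "L2_inner M ?p ?p = (\<Sum>i\<in>F. a i * cnj (a i))" .
  have "complex_of_real ((L2_norm M (\<lambda>x. f x - ?p x))\<^sup>2) =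
      L2_inner M f f - L2_inner M f ?p - (L2_inner M ?p f - L2_inner M ?p ?p)"
    unfolding L2_inner_self[symmetric]
    by (simp only: L2_inner_diff_left[OF f p L2_diff[OF f p]] L2_inner_diff_right[OF f p f] L2_inner_diff_right[OF f p p])
  also have "\<dots> = complex_of_real ((L2_norm M f)\<^sup>2) - (\<Sum>i\<in>F. cnj (a i) * c i) - (\<Sum>i\<in>F. a i * cnj (c i)) + (\<Sum>i\<in>F. a i * cnj (a i))"
    unfolding fp pf pp unfolding L2_inner_self by simp
  also have "\<dots> = complex_of_real ((L2_norm M f)\<^sup>2 - (\<Sum>i\<in>F. (cmod (c i))\<^sup>2) + (\<Sum>i\<in>F. (cmod (c i - a i))\<^sup>2))"
    unfolding of_real_add of_real_diff of_real_sum complex_norm_square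
    by (simp add: sum_subtractf sum.distrib algebra_simps)
  finally show ?thesis
    unfolding c_def of_real_eq_iff .
qed

text \<open>
  Good approximation by some finite combination forces the partial sums over all larger index sets
  to come close to \<open>\<parallel>f\<parallel>\<^sup>2\<close>, since Fourier coefficients approximate best.
\<close>

lemma Parseval_if_total:
  assumes e: "\<And>i. e i \<in> L2 M" and f: "f \<in> L2 M"
    and orth: "\<And>i j. L2_inner M (e i) (e j) = (if i = j then 1 else 0)"
    and total: "\<And>\<epsilon>. \<epsilon> > 0 \<Longrightarrow> \<exists>F a. finite F \<and> (L2_norm M (\<lambda>x. f x - (\<Sum>i\<in>F. a i * e i x)))\<^sup>2 < \<epsilon>"
  shows "((\<lambda>i. (cmod (L2_inner M f (e i)))\<^sup>2) has_sum (L2_norm M f)\<^sup>2) UNIV"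
  unfolding has_sum_def
proof (rule tendstoI)
  fix \<epsilon> :: real assume "\<epsilon> > 0"
  then obtain F a where F: "finite F" and a: "(L2_norm M (\<lambda>x. f x - (\<Sum>i\<in>F. a i * e i x)))\<^sup>2 < \<epsilon>"
    using total by blast
  have "0 \<le> (\<Sum>i\<in>F. (cmod (L2_inner M f (e i) - a i))\<^sup>2)"
    by (intro sum_nonneg) auto
  then have lower: "(L2_norm M f)\<^sup>2 - \<epsilon> < (\<Sum>i\<in>F. (cmod (L2_inner M f (e i)))\<^sup>2)"
    using a L2_orthonormal_distance[OF F e f orth, of a] by simp
  have Bessel: "(\<Sum>i\<in>E. (cmod (L2_inner M f (e i)))\<^sup>2) \<le> (L2_norm M f)\<^sup>2" if "finite E" for E
    using L2_orthonormal_distance[OF that e f orth, of "\<lambda>i. L2_inner M f (e i)"]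
      zero_le_power2[of "L2_norm M (\<lambda>x. f x - (\<Sum>i\<in>E. L2_inner M f (e i) * e i x))"] by simp
  show "\<forall>\<^sub>F E in finite_subsets_at_top UNIV.
      dist (\<Sum>i\<in>E. (cmod (L2_inner M f (e i)))\<^sup>2) ((L2_norm M f)\<^sup>2) < \<epsilon>"
    unfolding eventually_finite_subsets_at_top
  proof (intro exI[of _ F] conjI allI impI F)
    fix E assume E: "finite E \<and> F \<subseteq> E \<and> E \<subseteq> UNIV"
    then have "(\<Sum>i\<in>F. (cmod (L2_inner M f (e i)))\<^sup>2) \<le> (\<Sum>i\<in>E. (cmod (L2_inner M f (e i)))\<^sup>2)"
      by (intro sum_mono2) auto
    then show "dist (\<Sum>i\<in>E. (cmod (L2_inner M f (e i)))\<^sup>2) ((L2_norm M f)\<^sup>2) < \<epsilon>"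
      using lower Bessel[of E] E by (simp add: dist_real_def)
  qed simp
qed

lemma w_eq_cis:
  "w P j k p = complex_of_real (1 / (2 * period P)) *
     cis (of_int j * (pi / period P) * fst p + of_int k * (pi / period P) * snd p)"
  by (simp add: w_def cis_conv_exp distrib_left exp_add)

lemma cmod_w: "0 < period P \<Longrightarrow> cmod (w P j k p) = 1 / (2 * period P)"
  by (simp add: w_eq_cis norm_mult norm_divide)

lemma w_add: "0 < period P \<Longrightarrow> w P j k (p + q) = 2 * period P * w P j k p * w P j k q"
  by (simp add: w_eq_cis cis_mult algebra_simps add_divide_distrib)

lemma cnj_w: "cnj (w P j k p) = w P (- j) (- k) p"
  by (simp add: w_eq_cis cis_cnj)

lemma w_uminus: "w P j k (- p) = cnj (w P j k p)"
  by (simp add: w_eq_cis cis_cnj)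

lemma w_mult: "w P j k p * w P j' k' p = complex_of_real (1 / (2 * period P)) * w P (j + j') (k + k') p"
  by (simp add: w_eq_cis cis_mult algebra_simps)

lemma continuous_on_w: "continuous_on A (w P j k)"
  unfolding w_def by (intro continuous_intros)

lemma period_square_cbox: "period_square P = cbox (- period P, - period P) (period P, period P)"
  by (simp add: period_square_def cbox_Pair_eq)

lemma period_square_lmeasurable: "period_square P \<in> lmeasurable"
  unfolding period_square_cbox by (rule lmeasurable_cbox)

lemma L2_bounded:
  assumes "finite_measure M" "f \<in> borel_measurable M" "\<And>x. x \<in> space M \<Longrightarrow> cmod (f x) \<le> B"
  shows "f \<in> L2 M"
proof (rule L2I)
  show "integrable M (\<lambda>x. (cmod (f x))\<^sup>2)"
    using assms by (intro finite_measure.integrable_const_bound[where B = "B\<^sup>2"] AE_I2)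
      (auto intro: power_mono)
qed fact

lemma L2_continuous:
  assumes "compact S" "continuous_on S f"
  shows "f \<in> L2 (lebesgue_on S)"
proof -
  obtain B where "\<And>x. x \<in> S \<Longrightarrow> cmod (f x) \<le> B"
    using compact_imp_bounded[OF compact_continuous_image[OF assms(2,1)]] by (auto simp: bounded_iff)
  then show ?thesis
    using assms lmeasurable_compact[OF assms(1)]
    by (intro L2_bounded[where B = B] finite_measure_lebesgue_on continuous_imp_measurable_on_sets_lebesgue)
       auto
qed

lemma integral_exp_period:
  assumes "0 < T"
  shows "integral {-T..T} (\<lambda>x. exp (\<i> * complex_of_real (of_int m * (pi / T) * x))) = (if m = 0 then 2 * T else 0)"
proof (cases "m = 0")
  case True
  then show ?thesis using assms by (simp add: scaleR_conv_of_real)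
next
  case False
  define \<omega> where "\<omega> = of_int m * (pi / T)"
  have \<omega>: "\<omega> \<noteq> 0" using False assms by (simp add: \<omega>_def)
  have "((\<lambda>x. exp (\<i> * complex_of_real (\<omega> * x))) has_integral
      exp (\<i> * complex_of_real (\<omega> * T)) / (\<i> * \<omega>) - exp (\<i> * complex_of_real (\<omega> * (- T))) / (\<i> * \<omega>)) {-T..T}"
  proof (rule fundamental_theorem_of_calculus)
    fix x assume "x \<in> {- T..T}"
    have "((\<lambda>z. exp (\<i> * complex_of_real \<omega> * z) / (\<i> * \<omega>)) has_field_derivative
        exp (\<i> * complex_of_real \<omega> * complex_of_real x)) (at (complex_of_real x))"
      using \<omega> by (auto intro!: derivative_eq_intros)
    from has_vector_derivative_real_field[OF this]
    show "((\<lambda>x. exp (\<i> * complex_of_real (\<omega> * x)) / (\<i> * \<omega>)) has_vector_derivative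
        exp (\<i> * complex_of_real (\<omega> * x))) (at x within {- T..T})"
      by (simp add: o_def mult.assoc)
  qed (use assms in auto)
  moreover have "exp (\<i> * complex_of_real (\<omega> * T)) = exp (\<i> * complex_of_real (\<omega> * (- T)))"
  proof -
    have "\<omega> * T = of_int m * pi" using assms by (simp add: \<omega>_def)
    moreover have "sin (of_int m * pi) = 0"
      by (simp add: sin_times_pi_eq_0)
    ultimately show ?thesis
      unfolding cis_conv_exp[symmetric] by (simp add: complex_eq_iff)
  qed
  ultimately show ?thesis
    using False by (simp add: integral_unique \<omega>_def)
qed

text \<open>
  Fubini on the square reduces orthogonality to one variable.
\<close>

lemma integral_w:
  assumes T: "0 < period P"
  shows "(LINT x|lebesgue_on (period_square P). w P m n x) = (if m = 0 \<and> n = 0 then 2 * period P else 0)"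
proof -
  let ?T = "period P"
  let ?e = "\<lambda>m x. exp (\<i> * complex_of_real (of_int m * (pi / ?T) * x))"
  have int: "integrable (lebesgue_on (period_square P)) (w P m n)"
    using cmod_w[OF T] period_square_lmeasurable[of P]
    by (intro finite_measure.integrable_const_bound[where B = "1 / (2 * ?T)"] finite_measure_lebesgue_on
        continuous_imp_measurable_on_sets_lebesgue continuous_on_w) auto
  have "(LINT x|lebesgue_on (period_square P). w P m n x) = integral (period_square P) (w P m n)"
    by (rule lebesgue_integral_eq_integral[OF int]) (use period_square_lmeasurable in blast)
  also have "\<dots> = integral {-?T..?T} (\<lambda>x. integral {-?T..?T} (\<lambda>y. w P m n (x, y)))"
    unfolding period_square_cbox cbox_interval[symmetric]
    by (rule integral_prod_continuous) (rule continuous_on_w)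
  also have "\<dots> = complex_of_real (1 / (2 * ?T)) * integral {-?T..?T} (?e m) * integral {-?T..?T} (?e n)"
    by (simp add: w_def)
  finally show ?thesis
    unfolding integral_exp_period[OF T] using T by simp
qed

lemma L2_w: "w P j k \<in> L2 (lebesgue_on (period_square P))"
  by (rule L2_continuous) (auto simp: period_square_cbox continuous_on_w)

lemma w_orthonormal:
  assumes T: "0 < period P"
  shows "L2_inner (lebesgue_on (period_square P)) (w P j k) (w P j' k') = (if j = j' \<and> k = k' then 1 else 0)"
  unfolding L2_inner_def cnj_w w_mult using integral_w[OF T, of "j + - j'" "k + - k'"] T
  by simp

text \<open>
  The linear span of the exponentials, generated one term at a time: this makes closure under
  sums and products a matter of induction.
\<close>

inductive_set trig_polys :: "tomography \<Rightarrow> (real \<times> real \<Rightarrow> complex) set" for P where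
  zero: "(\<lambda>x. 0) \<in> trig_polys P"
| add_term: "p \<in> trig_polys P \<Longrightarrow> (\<lambda>x. p x + a * w P j k x) \<in> trig_polys P"

lemma trig_polys_add: "q \<in> trig_polys P \<Longrightarrow> p \<in> trig_polys P \<Longrightarrow> (\<lambda>x. p x + q x) \<in> trig_polys P"
proof (induction rule: trig_polys.induct)
  case (add_term q a j k)
  then show ?case using trig_polys.add_term[of "\<lambda>x. p x + q x" P a j k] by (simp add: add.assoc)
qed simp

lemma trig_polys_cmult: "p \<in> trig_polys P \<Longrightarrow> (\<lambda>x. c * p x) \<in> trig_polys P"
proof (induction rule: trig_polys.induct)
  case (add_term q a j k)
  then show ?case using trig_polys.add_term[of "\<lambda>x. c * q x" P "c * a" j k] by (simp add: distrib_left mult.assoc)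
qed (simp add: trig_polys.zero)

lemma trig_polys_w: "(\<lambda>x. a * w P j k x) \<in> trig_polys P"
  using trig_polys.add_term[OF trig_polys.zero, where a = a and j = j and k = k] by simp

lemma trig_polys_mult: "q \<in> trig_polys P \<Longrightarrow> p \<in> trig_polys P \<Longrightarrow> (\<lambda>x. p x * q x) \<in> trig_polys P"
proof (induction rule: trig_polys.induct)
  case (add_term q a j k)
  have "(\<lambda>x. p x * w P j k x) \<in> trig_polys P"
    using \<open>p \<in> trig_polys P\<close>
  proof (induction rule: trig_polys.induct)
    case (add_term p b j' k')
    have "(\<lambda>x. p x * w P j k x + (b * (1 / (2 * period P))) * w P (j' + j) (k' + k) x) \<in> trig_polys P"
      by (rule trig_polys.add_term[OF add_term.IH])
    moreover have "p x * w P j k x + (b * (1 / (2 * period P))) * w P (j' + j) (k' + k) x =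
        (p x + b * w P j' k' x) * w P j k x" for x
      using w_mult[of P j' k' x j k] by (simp add: distrib_right mult.assoc)
    ultimately show ?case by simp
  qed (simp add: trig_polys.zero)
  from trig_polys_add[OF trig_polys_cmult[OF this, of a] add_term.IH[OF add_term.prems]]
  show ?case by (simp add: distrib_left mult_ac)
qed (simp add: trig_polys.zero)

lemma trig_polys_const: "0 < period P \<Longrightarrow> (\<lambda>x. c) \<in> trig_polys P"
  using trig_polys_w[where P = P and a = "c * (2 * period P)" and j = 0 and k = 0] by (simp add: w_def)

lemma trig_polys_sum_form:
  "p \<in> trig_polys P \<Longrightarrow> \<exists>F a. finite F \<and> p = (\<lambda>x. \<Sum>i\<in>F. a i * w P (fst i) (snd i) x)"
proof (induction rule: trig_polys.induct)
  case zero
  show ?case by (rule exI[of _ "{}"]) simp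
next
  case (add_term p c j k)
  then obtain F a where F: "finite F" and p: "p = (\<lambda>x. \<Sum>i\<in>F. a i * w P (fst i) (snd i) x)"
    by blast
  define b where "b i = (if i \<in> F then a i else 0) + (if i = (j, k) then c else 0)" for i
  have "p x + c * w P j k x = (\<Sum>i\<in>insert (j, k) F. b i * w P (fst i) (snd i) x)" for x
  proof -
    have "(\<Sum>i\<in>insert (j, k) F. b i * w P (fst i) (snd i) x) =
        (\<Sum>i\<in>insert (j, k) F. (if i \<in> F then a i * w P (fst i) (snd i) x else 0))
        + (\<Sum>i\<in>insert (j, k) F. (if i = (j, k) then c * w P j k x else 0))"
      unfolding sum.distrib[symmetric] b_def by (intro sum.cong refl) (auto simp: distrib_right)
    also have "(\<Sum>i\<in>insert (j, k) F. (if i \<in> F then a i * w P (fst i) (snd i) x else 0)) = p x"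
      unfolding p using F by (intro sum.mono_neutral_cong_right) auto
    also have "(\<Sum>i\<in>insert (j, k) F. (if i = (j, k) then c * w P j k x else 0)) = c * w P j k x"
      using F by simp
    finally show ?thesis by simp
  qed
  then show ?case using F by blast
qed

text \<open>
  The square, wrapped onto the torus inside \<open>\<complex>\<^sup>2\<close>; polynomials on \<open>\<complex>\<^sup>2\<close> (as a real vector space)
  pull back to trigonometric polynomials.
\<close>

definition torus_point :: "tomography \<Rightarrow> real \<times> real \<Rightarrow> complex \<times> complex" where
  "torus_point P p = (cis (pi / period P * fst p), cis (pi / period P * snd p))"

text \<open>
  Real linear functionals pull back to combinations of the sines and cosines of the two
  coordinates; products and sums stay inside the span.
\<close>

lemma trig_polys_real_polynomial:
  assumes T: "0 < period P"
  shows "real_polynomial_function q \<Longrightarrow> (\<lambda>p. complex_of_real (q (torus_point P p))) \<in> trig_polys P"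
proof (induction rule: real_polynomial_function.induct)
  case (linear q)
  then interpret bounded_linear q .
  have repr: "q (z1, z2) = Re z1 * q (1, 0) + Im z1 * q (\<i>, 0) + Re z2 * q (0, 1) + Im z2 * q (0, \<i>)" for z1 z2
  proof -
    have "(z1, z2) = Re z1 *\<^sub>R (1, 0) + Im z1 *\<^sub>R (\<i>, 0) + Re z2 *\<^sub>R (0, 1) + Im z2 *\<^sub>R (0, \<i>)"
      by (simp add: complex_eq_iff)
    then have "q (z1, z2) = q (Re z1 *\<^sub>R (1, 0) + Im z1 *\<^sub>R (\<i>, 0) + Re z2 *\<^sub>R (0, 1) + Im z2 *\<^sub>R (0, \<i>))"
      by (rule arg_cong)
    then show ?thesis
      by (simp only: add scaleR real_scaleR_def)
  qed
  have cos_eq: "complex_of_real (cos t) = (cis t + cis (- t)) / 2" for t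
    by (simp add: complex_eq_iff)
  have sin_eq: "complex_of_real (sin t) = (cis t - cis (- t)) / (2 * \<i>)" for t
    by (simp add: complex_eq_iff Re_divide Im_divide)
  have 1: "(\<lambda>p. c * cis (pi / period P * fst p)) \<in> trig_polys P"
    "(\<lambda>p. c * cis (- (pi / period P * fst p))) \<in> trig_polys P"
    "(\<lambda>p. c * cis (pi / period P * snd p)) \<in> trig_polys P"
    "(\<lambda>p. c * cis (- (pi / period P * snd p))) \<in> trig_polys P" for c
    using T trig_polys_w[where P = P and a = "c * (2 * period P)" and j = 1 and k = 0] trig_polys_w[where P = P and a = "c * (2 * period P)" and j = "-1" and k = 0]
      trig_polys_w[where P = P and a = "c * (2 * period P)" and j = 0 and k = 1] trig_polys_w[where P = P and a = "c * (2 * period P)" and j = 0 and k = "-1"]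
    by (simp_all add: w_eq_cis)
  have 2: "(\<lambda>p. complex_of_real (cos (pi / period P * fst p)) * c) \<in> trig_polys P"
    "(\<lambda>p. complex_of_real (sin (pi / period P * fst p)) * c) \<in> trig_polys P"
    "(\<lambda>p. complex_of_real (cos (pi / period P * snd p)) * c) \<in> trig_polys P"
    "(\<lambda>p. complex_of_real (sin (pi / period P * snd p)) * c) \<in> trig_polys P" for c
    unfolding cos_eq sin_eq
    using trig_polys_add[OF 1(1)[of "c / 2"] 1(2)[of "c / 2"]]
      trig_polys_add[OF 1(1)[of "c / (2 * \<i>)"] 1(2)[of "- c / (2 * \<i>)"]]
      trig_polys_add[OF 1(3)[of "c / 2"] 1(4)[of "c / 2"]]
      trig_polys_add[OF 1(3)[of "c / (2 * \<i>)"] 1(4)[of "- c / (2 * \<i>)"]]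
    by (simp_all add: field_simps)
  have "(\<lambda>p. complex_of_real (cos (pi / period P * fst p)) * complex_of_real (q (1, 0))
      + complex_of_real (sin (pi / period P * fst p)) * complex_of_real (q (\<i>, 0))
      + complex_of_real (cos (pi / period P * snd p)) * complex_of_real (q (0, 1))
      + complex_of_real (sin (pi / period P * snd p)) * complex_of_real (q (0, \<i>))) \<in> trig_polys P"
    by (intro trig_polys_add 2)
  then show ?case
    unfolding torus_point_def
      repr[of "cis (pi / period P * fst _)" "cis (pi / period P * snd _)"] by simp
next
  case (const c)
  then show ?case by (rule trig_polys_const[OF T])
next
  case (add f g)
  then show ?case using trig_polys_add by simp
next
  case (mult f g)
  then show ?case using trig_polys_mult by simp
qed

lemma trig_polys_polynomial:
  assumes T: "0 < period P" and q: "polynomial_function q"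
  shows "(\<lambda>p. q (torus_point P p)) \<in> trig_polys P"
proof -
  have "(\<lambda>p. complex_of_real ((Re \<circ> q) (torus_point P p)) + complex_of_real ((Im \<circ> q) (torus_point P p)) * \<i>) \<in> trig_polys P"
    using q bounded_linear_Re bounded_linear_Im unfolding polynomial_function_def
    by (intro trig_polys_add trig_polys_mult trig_polys_real_polynomial T trig_polys_const) blast+
  moreover have "complex_of_real ((Re \<circ> q) z) + complex_of_real ((Im \<circ> q) z) * \<i> = q z" for z
    by (simp add: complex_eq_iff)
  ultimately show ?thesis by simp
qed

lemma continuous_on_trig_poly: "p \<in> trig_polys P \<Longrightarrow> continuous_on A p"
  by (induction rule: trig_polys.induct) (auto intro!: continuous_intros continuous_on_w)

text \<open>
  Membership in the closed span of the exponentials.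
\<close>

definition trig_approximable :: "tomography \<Rightarrow> (real \<times> real \<Rightarrow> complex) \<Rightarrow> bool" where
  "trig_approximable P f \<longleftrightarrow> f \<in> L2 (lebesgue_on (period_square P)) \<and>
     (\<forall>\<epsilon>>0. \<exists>p\<in>trig_polys P. (L2_norm (lebesgue_on (period_square P)) (\<lambda>x. f x - p x))\<^sup>2 < \<epsilon>)"

lemma trig_polys_L2: "p \<in> trig_polys P \<Longrightarrow> p \<in> L2 (lebesgue_on (period_square P))"
  by (rule L2_continuous) (auto simp: period_square_cbox continuous_on_trig_poly)

lemma trig_polys_approximable: "p \<in> trig_polys P \<Longrightarrow> trig_approximable P p"
  unfolding trig_approximable_def by (auto simp: trig_polys_L2 L2_norm_def intro!: bexI[of _ p])

lemma L2_norm_sq_add_le: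
  assumes "f \<in> L2 M" "g \<in> L2 M"
  shows "(L2_norm M (\<lambda>x. f x + g x))\<^sup>2 \<le> 2 * (L2_norm M f)\<^sup>2 + 2 * (L2_norm M g)\<^sup>2"
proof -
  have "(L2_norm M (\<lambda>x. f x + g x))\<^sup>2 \<le> (LINT x|M. 2 * (cmod (f x))\<^sup>2 + 2 * (cmod (g x))\<^sup>2)"
    unfolding L2_norm_squared using assms
    by (intro integral_mono norm_add_sq_le L2_integrable_norm[OF L2_add] Bochner_Integration.integrable_add
        integrable_mult_right L2_integrable_norm)
  also have "\<dots> = 2 * (L2_norm M f)\<^sup>2 + 2 * (L2_norm M g)\<^sup>2"
    unfolding L2_norm_squared by (simp add: L2_integrable_norm assms)
  finally show ?thesis .
qed

text \<open>
  The closed span is closed under dominated pointwise limits.  All the density steps below are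
  instances.
\<close>

lemma trig_approximable_limit:
  assumes f: "f \<in> L2 (lebesgue_on (period_square P))" and h: "\<And>n. trig_approximable P (h n)"
    and lim: "AE x in lebesgue_on (period_square P). (\<lambda>n. h n x) \<longlonglongrightarrow> f x"
    and W: "integrable (lebesgue_on (period_square P)) W"
    and bound: "\<And>n x. x \<in> period_square P \<Longrightarrow> (cmod (f x - h n x))\<^sup>2 \<le> W x"
  shows "trig_approximable P f"
  unfolding trig_approximable_def
proof (intro conjI f allI impI)
  let ?M = "lebesgue_on (period_square P)"
  fix \<epsilon> :: real assume \<epsilon>: "\<epsilon> > 0"
  have hL2: "h n \<in> L2 ?M" for n
    using h unfolding trig_approximable_def by blast
  have [measurable]: "f \<in> borel_measurable ?M" "h n \<in> borel_measurable ?M" for n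
    using f hL2 by (auto intro: L2_measurable)
  have "(\<lambda>n. LINT x|?M. (cmod (f x - h n x))\<^sup>2) \<longlonglongrightarrow> (LINT x|?M. 0)"
  proof (rule integral_dominated_convergence[OF _ _ W])
    show "AE x in ?M. (\<lambda>n. (cmod (f x - h n x))\<^sup>2) \<longlonglongrightarrow> 0"
      using lim
    proof eventually_elim
      case (elim x)
      then have "(\<lambda>n. (cmod (f x - h n x))\<^sup>2) \<longlonglongrightarrow> (cmod (f x - f x))\<^sup>2"
        by (intro tendsto_intros)
      then show ?case by simp
    qed
    show "AE x in ?M. norm ((cmod (f x - h n x))\<^sup>2) \<le> W x" for n
      using bound by (intro AE_I2) auto
  qed measurable
  then have "(\<lambda>n. (L2_norm ?M (\<lambda>x. f x - h n x))\<^sup>2) \<longlonglongrightarrow> 0"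
    unfolding L2_norm_squared by simp
  then have "\<forall>\<^sub>F n in sequentially. (L2_norm ?M (\<lambda>x. f x - h n x))\<^sup>2 < \<epsilon> / 4"
    by (rule order_tendstoD(2)) (use \<epsilon> in simp)
  then obtain n where n: "(L2_norm ?M (\<lambda>x. f x - h n x))\<^sup>2 < \<epsilon> / 4"
    by (auto simp: eventually_sequentially)
  obtain p where p: "p \<in> trig_polys P" "(L2_norm ?M (\<lambda>x. h n x - p x))\<^sup>2 < \<epsilon> / 4"
    using h[of n] \<epsilon> unfolding trig_approximable_def by (meson divide_pos_pos zero_less_numeral)
  have "(L2_norm ?M (\<lambda>x. (f x - h n x) + (h n x - p x)))\<^sup>2 < \<epsilon>"
    using L2_norm_sq_add_le[OF L2_diff[OF f hL2[of n]] L2_diff[OF hL2[of n] trig_polys_L2[OF p(1)]]] n p(2)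
    by linarith
  then show "\<exists>p\<in>trig_polys P. (L2_norm ?M (\<lambda>x. f x - p x))\<^sup>2 < \<epsilon>"
    using p(1) by auto
qed

lemma integrable_const_period_square: "integrable (lebesgue_on (period_square P)) (\<lambda>x. c :: real)"
  by (rule finite_measure.integrable_const[OF finite_measure_lebesgue_on[OF period_square_lmeasurable]])

text \<open>
  Weierstrass approximation on a compact set that contains the torus, uniformly with errors
  \<open>1 / (n + 1)\<close>.
\<close>

lemma trig_approximable_torus:
  assumes T: "0 < period P" and g: "continuous_on UNIV g"
  shows "trig_approximable P (\<lambda>p. g (torus_point P p))"
proof -
  let ?K = "cball 0 1 \<times> cball 0 1 :: (complex \<times> complex) set"
  have "\<exists>q. polynomial_function q \<and> (\<forall>z\<in>?K. norm (g z - q z) < inverse (real (Suc n)))" for n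
    by (rule Stone_Weierstrass_polynomial_function)
       (auto intro: compact_Times continuous_on_subset[OF g])
  then obtain q where q: "\<And>n. polynomial_function (q n)"
    and close: "\<And>n z. z \<in> ?K \<Longrightarrow> norm (g z - q n z) < inverse (real (Suc n))"
    by metis
  have K: "torus_point P p \<in> ?K" for p
    by (simp add: torus_point_def)
  have cont: "continuous_on A (torus_point P)" for A
    unfolding torus_point_def by (intro continuous_intros continuous_on_cis) 
  show ?thesis
  proof (rule trig_approximable_limit[where h = "\<lambda>n p. q n (torus_point P p)" and W = "\<lambda>_. 1"])
    show "(\<lambda>p. g (torus_point P p)) \<in> L2 (lebesgue_on (period_square P))"
      by (rule L2_continuous)
         (auto simp: period_square_cbox intro!: continuous_on_compose2[OF g] cont)
    show "trig_approximable P (\<lambda>p. q n (torus_point P p))" for n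
      by (intro trig_polys_approximable trig_polys_polynomial T q)
    have "(\<lambda>n. q n z) \<longlonglongrightarrow> g z" if "z \<in> ?K" for z
    proof (rule LIM_zero_cancel[OF Lim_null_comparison[OF _ LIMSEQ_inverse_real_of_nat]])
      show "\<forall>\<^sub>F n in sequentially. norm (q n z - g z) \<le> inverse (real (Suc n))"
        using close[OF that] by (intro always_eventually allI less_imp_le) (simp add: norm_minus_commute)
    qed
    then show "AE p in lebesgue_on (period_square P). (\<lambda>n. q n (torus_point P p)) \<longlonglongrightarrow> g (torus_point P p)"
      using K by simp
    show "(cmod (g (torus_point P p) - q n (torus_point P p)))\<^sup>2 \<le> 1" for n p
    proof -
      have "inverse (real (Suc n)) \<le> 1" by (simp add: inverse_le_1_iff)
      then have "cmod (g (torus_point P p) - q n (torus_point P p)) \<le> 1"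
        using close[OF K, of p n] by linarith
      then show ?thesis by (simp add: power_le_one)
    qed
  qed (rule integrable_const_period_square)
qed

text \<open>
  Continuous functions of \<open>z\<close> that recover the angle \<open>t \<in> (-\<pi>, \<pi>)\<close> from \<open>z = cis t\<close> in the limit: the
  first factor is \<open>\<bar>t\<bar>\<close>, the second tends to the sign of \<open>sin t\<close>, which is the sign of \<open>t\<close>.  No
  continuous function recovers the angle exactly, because it jumps at \<open>\<pi>\<close>; a bounded pointwise limit
  is enough in \<open>L\<^sub>2\<close>.
\<close>

definition angle_approx :: "nat \<Rightarrow> complex \<Rightarrow> real" where
  "angle_approx n z = arccos (max (- 1) (min 1 (Re z))) * (Im z / sqrt ((Im z)\<^sup>2 + inverse (real (Suc n))))"

lemma continuous_on_angle_approx: "continuous_on A (angle_approx n)"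
proof -
  have "sqrt ((Im z)\<^sup>2 + inverse (real (Suc n))) \<noteq> 0" for z
    using add_nonneg_pos[of "(Im z)\<^sup>2" "inverse (real (Suc n))"] by simp
  then show ?thesis
    unfolding angle_approx_def by (intro continuous_intros) auto
qed

lemma abs_angle_approx_le: "\<bar>angle_approx n z\<bar> \<le> pi"
proof -
  have "\<bar>arccos (max (- 1) (min 1 (Re z)))\<bar> \<le> pi"
    using arccos_lbound[of "max (- 1) (min 1 (Re z))"] arccos_ubound[of "max (- 1) (min 1 (Re z))"] by auto
  moreover have "\<bar>Im z / sqrt ((Im z)\<^sup>2 + inverse (real (Suc n)))\<bar> \<le> 1"
  proof -
    have "\<bar>Im z\<bar> \<le> sqrt ((Im z)\<^sup>2 + inverse (real (Suc n)))"
      by (rule real_le_rsqrt) simp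
    moreover have "0 < sqrt ((Im z)\<^sup>2 + inverse (real (Suc n)))"
      using add_nonneg_pos[of "(Im z)\<^sup>2" "inverse (real (Suc n))"] by simp
    ultimately show ?thesis by (simp add: abs_divide)
  qed
  ultimately have "\<bar>arccos (max (- 1) (min 1 (Re z)))\<bar> * \<bar>Im z / sqrt ((Im z)\<^sup>2 + inverse (real (Suc n)))\<bar> \<le> pi * 1"
    by (intro mult_mono) auto
  then show ?thesis by (simp add: angle_approx_def abs_mult)
qed

lemma angle_approx_tendsto:
  assumes "- pi < t" "t < pi"
  shows "(\<lambda>n. angle_approx n (cis t)) \<longlonglongrightarrow> t"
proof (cases "t = 0")
  case True
  then show ?thesis by (simp add: angle_approx_def)
next
  case False
  have arc: "arccos (cos t) = \<bar>t\<bar>"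
    using assms by (simp add: arccos_cos_eq_abs)
  have sin: "\<bar>t\<bar> * sgn (sin t) = t" "sin t \<noteq> 0"
    using sin_gt_zero[of t] sin_gt_zero[of "- t"] assms False by (cases "t > 0"; simp)+
  have "(\<lambda>n. \<bar>t\<bar> * (sin t / sqrt ((sin t)\<^sup>2 + inverse (real (Suc n))))) \<longlonglongrightarrow>
      \<bar>t\<bar> * (sin t / sqrt ((sin t)\<^sup>2 + 0))"
    using sin(2) by (intro tendsto_intros LIMSEQ_inverse_real_of_nat) auto
  moreover have "\<bar>t\<bar> * (sin t / sqrt ((sin t)\<^sup>2 + 0)) = t"
    using sin by (simp add: sgn_real_def abs_if split: if_splits)
  ultimately show ?thesis
    by (simp add: angle_approx_def arc)
qed

text \<open>
  Replacing the coordinates in \<open>g\<close> by the approximate angles gives continuous functions on the torus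
  that converge to \<open>g\<close> boundedly in the interior of the square.
\<close>

lemma trig_approximable_continuous:
  assumes T: "0 < period P" and g: "continuous_on UNIV g"
  shows "trig_approximable P g"
proof -
  define X where "X n z = period P / pi * angle_approx n z" for n z
  have X_le: "\<bar>X n z\<bar> \<le> period P" for n z
  proof -
    have "\<bar>X n z\<bar> = period P / pi * \<bar>angle_approx n z\<bar>"
      using T by (simp add: X_def abs_mult)
    also have "\<dots> \<le> period P / pi * pi"
      using T by (intro mult_left_mono abs_angle_approx_le) auto
    finally show ?thesis by simp
  qed
  have X_cont: "continuous_on A (X n)" for n A
    unfolding X_def by (intro continuous_intros continuous_on_angle_approx)
  have X_lim: "(\<lambda>n. X n (cis (pi / period P * t))) \<longlonglongrightarrow> t" if "- period P < t" "t < period P" for t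
  proof -
    have "(\<lambda>n. X n (cis (pi / period P * t))) \<longlonglongrightarrow> period P / pi * (pi / period P * t)"
    proof -
      have "pi / period P * (- period P) < pi / period P * t" "pi / period P * t < pi / period P * period P"
        using that T by (intro mult_strict_left_mono; simp)+
      then show ?thesis
        unfolding X_def using T by (intro tendsto_mult_left angle_approx_tendsto) auto
    qed
    then show ?thesis using T by simp
  qed
  obtain B where B: "\<And>p. p \<in> period_square P \<Longrightarrow> cmod (g p) \<le> B"
    using compact_imp_bounded[OF compact_continuous_image[OF continuous_on_subset[OF g]], of "period_square P"]
    by (auto simp: bounded_iff period_square_cbox)
  define h where "h n p = g (X n (fst (torus_point P p)), X n (snd (torus_point P p)))" for n p
  show ?thesis
  proof (rule trig_approximable_limit[where h = h and W = "\<lambda>_. (2 * B)\<^sup>2"])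
    show "g \<in> L2 (lebesgue_on (period_square P))"
      by (rule L2_continuous) (auto simp: period_square_cbox intro: continuous_on_subset[OF g])
    show "trig_approximable P (h n)" for n
    proof -
      have "continuous_on UNIV (\<lambda>z. g (X n (fst z), X n (snd z)))"
        by (rule continuous_on_compose2[OF g])
           (auto intro!: continuous_on_Pair continuous_on_compose2[OF X_cont[of UNIV]] continuous_intros)
      from trig_approximable_torus[OF T this] show ?thesis
        unfolding h_def .
    qed
    show "AE p in lebesgue_on (period_square P). (\<lambda>n. h n p) \<longlonglongrightarrow> g p"
    proof -
      have "negligible (cbox (- period P, - period P) (period P, period P)
          - box (- period P, - period P) (period P, period P))"
        by (rule negligible_frontier_interval)
      then have "AE p in lebesgue. p \<notin> cbox (- period P, - period P) (period P, period P)
          - box (- period P, - period P) (period P, period P)"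
        unfolding negligible_iff_null_sets by (rule AE_not_in)
      then have "AE p in lebesgue. p \<in> period_square P \<longrightarrow> (\<lambda>n. h n p) \<longlonglongrightarrow> g p"
      proof eventually_elim
        case (elim p)
        show ?case
        proof
          assume "p \<in> period_square P"
          then have "p \<in> box (- period P, - period P) (period P, period P)"
            using elim by (simp add: period_square_cbox)
          then have b: "- period P < fst p" "fst p < period P" "- period P < snd p" "snd p < period P"
            by (auto simp: mem_box Basis_prod_def inner_prod_def)
          have "(\<lambda>n. (X n (fst (torus_point P p)), X n (snd (torus_point P p)))) \<longlonglongrightarrow> (fst p, snd p)"
            unfolding torus_point_def fst_conv snd_conv by (intro tendsto_Pair X_lim b)
          then have "(\<lambda>n. (X n (fst (torus_point P p)), X n (snd (torus_point P p)))) \<longlonglongrightarrow> p"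
            by simp
          then show "(\<lambda>n. h n p) \<longlonglongrightarrow> g p"
            unfolding h_def using g continuous_on_eq_continuous_at[OF open_UNIV, of g]
            by (intro isCont_tendsto_compose[of p g]) blast+
        qed
      qed
      then show ?thesis
        using period_square_lmeasurable by (subst AE_restrict_space_iff) auto
    qed
    show "(cmod (g p - h n p))\<^sup>2 \<le> (2 * B)\<^sup>2" if "p \<in> period_square P" for n p
    proof -
      have "(X n (fst (torus_point P p)), X n (snd (torus_point P p))) \<in> period_square P"
        using X_le[of n] by (simp add: period_square_def abs_le_iff minus_le_iff)
      then have "cmod (h n p) \<le> B" unfolding h_def by (rule B)
      then have "cmod (g p - h n p) \<le> 2 * B"
        using norm_triangle_ineq4[of "g p" "h n p"] B[OF that] by linarith
      then show ?thesis by (rule power_mono) simp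
    qed
  qed (rule integrable_const_period_square)
qed

text \<open>
  A measurable function is an almost everywhere limit of continuous functions.  Projecting those
  to the disc of radius \<open>B\<close> keeps them continuous and makes the convergence dominated.
\<close>

lemma trig_approximable_bounded:
  assumes T: "0 < period P" and f: "f \<in> borel_measurable (lebesgue_on (period_square P))"
    and B: "\<And>x. cmod (f x) \<le> B"
  shows "trig_approximable P f"
proof -
  have S: "period_square P \<in> sets lebesgue"
    using period_square_lmeasurable by auto
  have "f measurable_on period_square P"
    using f measurable_on_iff_borel_measurable[OF S] by blast
  then obtain N g where N: "negligible N" and g: "\<And>n. continuous_on UNIV (g n)"
    and lim: "\<And>x. x \<notin> N \<Longrightarrow> (\<lambda>n. g n x) \<longlonglongrightarrow> (if x \<in> period_square P then f x else 0)"
    unfolding measurable_on_def by blast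
  have B0: "0 \<le> B" using B[of 0] norm_ge_zero order_trans by blast
  let ?cl = "closest_point (cball (0::complex) B)"
  have ball: "convex (cball (0::complex) B)" "closed (cball (0::complex) B)" "cball (0::complex) B \<noteq> {}"
    using B0 by auto
  have cl_cont: "continuous_on A ?cl" for A
    by (rule continuous_on_closest_point[OF ball])
  have cl_le: "cmod (?cl z) \<le> B" for z
    using closest_point_in_set[OF ball(2,3), of z] by simp
  show ?thesis
  proof (rule trig_approximable_limit[where h = "\<lambda>n x. ?cl (g n x)" and W = "\<lambda>_. (2 * B)\<^sup>2"])
    show "f \<in> L2 (lebesgue_on (period_square P))"
      by (rule L2_bounded[OF finite_measure_lebesgue_on[OF period_square_lmeasurable] f B])
    show "trig_approximable P (\<lambda>x. ?cl (g n x))" for n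
      by (intro trig_approximable_continuous T continuous_on_compose2[OF cl_cont[of UNIV] g]) auto
    have "AE x in lebesgue. x \<notin> N"
      using N unfolding negligible_iff_null_sets by (rule AE_not_in)
    then have "AE x in lebesgue. x \<in> period_square P \<longrightarrow> (\<lambda>n. ?cl (g n x)) \<longlonglongrightarrow> f x"
    proof eventually_elim
      case (elim x)
      show ?case
      proof
        assume x: "x \<in> period_square P"
        have "(\<lambda>n. ?cl (g n x)) \<longlonglongrightarrow> ?cl (f x)"
          using lim[OF elim] x cl_cont[of UNIV]
          by (intro isCont_tendsto_compose[of _ ?cl]) (auto simp: continuous_on_eq_continuous_at)
        moreover have "?cl (f x) = f x"
          using B[of x] by (intro closest_point_self) simp
        ultimately show "(\<lambda>n. ?cl (g n x)) \<longlonglongrightarrow> f x" by simp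
      qed
    qed
    then show "AE x in lebesgue_on (period_square P). (\<lambda>n. ?cl (g n x)) \<longlonglongrightarrow> f x"
      using S by (subst AE_restrict_space_iff) auto
    show "(cmod (f x - ?cl (g n x)))\<^sup>2 \<le> (2 * B)\<^sup>2" for n x
    proof -
      have "cmod (f x - ?cl (g n x)) \<le> 2 * B"
        using norm_triangle_ineq4[of "f x" "?cl (g n x)"] B[of x] cl_le[of "g n x"] by linarith
      then show ?thesis by (rule power_mono) simp
    qed
  qed (rule integrable_const_period_square)
qed

text \<open>
  Truncation at height \<open>n\<close>, with \<open>|f|\<^sup>2\<close> dominating the squared error.
\<close>

lemma trig_approximable_L2:
  assumes T: "0 < period P" and f: "f \<in> L2 (lebesgue_on (period_square P))"
  shows "trig_approximable P f"
proof -
  define h where "h n x = (if cmod (f x) \<le> real n then f x else 0)" for n x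
  have [measurable]: "f \<in> borel_measurable (lebesgue_on (period_square P))"
    using f by (rule L2_measurable)
  show ?thesis
  proof (rule trig_approximable_limit[OF f, where h = h and W = "\<lambda>x. (cmod (f x))\<^sup>2"])
    show "trig_approximable P (h n)" for n
    proof (rule trig_approximable_bounded[OF T])
      show "h n \<in> borel_measurable (lebesgue_on (period_square P))"
        unfolding h_def by measurable
      show "cmod (h n x) \<le> real n" for x
        by (simp add: h_def)
    qed
    have "(\<lambda>n. h n x) \<longlonglongrightarrow> f x" for x
    proof (rule tendsto_eventually)
      obtain m where "cmod (f x) \<le> real m" using real_arch_simple by blast
      then show "\<forall>\<^sub>F n in sequentially. h n x = f x"
        unfolding h_def eventually_sequentially by (intro exI[of _ m]) auto
    qed
    then show "AE x in lebesgue_on (period_square P). (\<lambda>n. h n x) \<longlonglongrightarrow> f x"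
      by simp
    show "integrable (lebesgue_on (period_square P)) (\<lambda>x. (cmod (f x))\<^sup>2)"
      by (rule L2_integrable_norm[OF f])
  qed (simp add: h_def)
qed

lemma Parseval_square:
  assumes T: "0 < period P" and f: "f \<in> L2 (lebesgue_on (period_square P))"
  shows "((\<lambda>(j, k). (cmod (L2_inner (lebesgue_on (period_square P)) f (w P j k)))\<^sup>2)
    has_sum (L2_norm (lebesgue_on (period_square P)) f)\<^sup>2) UNIV"
proof -
  have "((\<lambda>i. (cmod (L2_inner (lebesgue_on (period_square P)) f (w P (fst i) (snd i))))\<^sup>2)
    has_sum (L2_norm (lebesgue_on (period_square P)) f)\<^sup>2) UNIV"
  proof (rule Parseval_if_total[OF L2_w f])
    show "L2_inner (lebesgue_on (period_square P)) (w P (fst i) (snd i)) (w P (fst j) (snd j)) =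
        (if i = j then 1 else 0)" for i j
      by (simp add: w_orthonormal[OF T] prod_eq_iff)
    fix \<epsilon> :: real assume "\<epsilon> > 0"
    then obtain p where p: "p \<in> trig_polys P" "(L2_norm (lebesgue_on (period_square P)) (\<lambda>x. f x - p x))\<^sup>2 < \<epsilon>"
      using trig_approximable_L2[OF T f] unfolding trig_approximable_def by blast
    then show "\<exists>F a. finite F \<and> (L2_norm (lebesgue_on (period_square P))
        (\<lambda>x. f x - (\<Sum>i\<in>F. a i * w P (fst i) (snd i) x)))\<^sup>2 < \<epsilon>"
      using trig_polys_sum_form[OF p(1)] by blast
  qed
  then show ?thesis by (simp add: case_prod_beta')
qed

lemma lebesgue_on_subset_integral:
  fixes F :: "'a::euclidean_space \<Rightarrow> 'b::{banach, second_countable_topology}"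
  assumes "A \<in> sets lebesgue" "S \<in> sets lebesgue" "A \<subseteq> S"
  shows "integrable (lebesgue_on A) F \<longleftrightarrow> integrable (lebesgue_on S) (\<lambda>x. indicator A x *\<^sub>R F x)"
    "(LINT x|lebesgue_on A. F x) = (LINT x|lebesgue_on S. indicator A x *\<^sub>R F x)"
proof -
  have *: "indicator S x *\<^sub>R indicator A x *\<^sub>R F x = indicator A x *\<^sub>R F x" for x
    using assms(3) by (auto simp: indicator_def)
  show "integrable (lebesgue_on A) F \<longleftrightarrow> integrable (lebesgue_on S) (\<lambda>x. indicator A x *\<^sub>R F x)"
    using assms by (simp add: integrable_restrict_space * del: scaleR_scaleR)
  show "(LINT x|lebesgue_on A. F x) = (LINT x|lebesgue_on S. indicator A x *\<^sub>R F x)"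
    using assms by (simp add: integral_restrict_space * del: scaleR_scaleR)
qed

text \<open>
  On a subset of the square the exponentials are in general only a Parseval frame, not a basis.  The identity
  is the one on the square for the extension of \<open>f\<close> by zero.
\<close>

theorem Parseval_subset:
  assumes T: "0 < period P" and A: "A \<in> sets lebesgue" "A \<subseteq> period_square P"
    and f: "f \<in> L2 (lebesgue_on A)"
  shows "((\<lambda>(j, k). (cmod (L2_inner (lebesgue_on A) f (w P j k)))\<^sup>2)
    has_sum (L2_norm (lebesgue_on A) f)\<^sup>2) UNIV"
proof -
  let ?S = "period_square P"
  have S: "?S \<in> sets lebesgue"
    using period_square_lmeasurable by auto
  note on_A = lebesgue_on_subset_integral[OF A(1) S A(2)]
  define g where "g x = indicator A x *\<^sub>R f x" for x
  have sq: "indicator A x *\<^sub>R (cmod (f x))\<^sup>2 = (cmod (g x))\<^sup>2" for x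
    by (simp add: g_def indicator_def)
  have g: "g \<in> L2 (lebesgue_on ?S)"
  proof (rule L2I)
    have "(\<lambda>x. indicator A x *\<^sub>R f x) \<in> borel_measurable lebesgue"
      using L2_measurable[OF f] A(1) borel_measurable_restrict_space_iff[of A lebesgue f] by simp
    then show "g \<in> borel_measurable (lebesgue_on ?S)"
      unfolding g_def by (rule measurable_restrict_space1)
    show "integrable (lebesgue_on ?S) (\<lambda>x. (cmod (g x))\<^sup>2)"
      using L2_integrable_norm[OF f] unfolding on_A(1) sq .
  qed
  have "L2_norm (lebesgue_on A) f = L2_norm (lebesgue_on ?S) g"
    unfolding L2_norm_def on_A(2) sq ..
  moreover have "L2_inner (lebesgue_on A) f (w P j k) = L2_inner (lebesgue_on ?S) g (w P j k)" for j k
    unfolding L2_inner_def on_A(2) by (simp add: g_def)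
  ultimately show ?thesis
    using Parseval_square[OF T g] by simp
qed

section \<open>Affine changes of variables\<close>

lemma lebesgue_affine:
  fixes b :: "'a::euclidean_space"
  assumes "c \<noteq> 0"
  shows "lebesgue = density (distr lebesgue lebesgue (\<lambda>x. c *\<^sub>R x + b)) (\<lambda>_. ennreal (\<bar>c\<bar> ^ DIM('a)))"
    and "(\<lambda>x. c *\<^sub>R x + b) \<in> lebesgue \<rightarrow>\<^sub>M lebesgue"
proof -
  have *: "b + (\<Sum>j\<in>Basis. (c * inner x j) *\<^sub>R j) = c *\<^sub>R x + b" for x :: 'a
    by (simp only: scaleR_scaleR[symmetric] scaleR_sum_right[symmetric] euclidean_representation add.commute)
  show "lebesgue = density (distr lebesgue lebesgue (\<lambda>x. c *\<^sub>R x + b)) (\<lambda>_. ennreal (\<bar>c\<bar> ^ DIM('a)))"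
    using lebesgue_affine_euclidean[of "\<lambda>_. c" b] assms by (simp add: *)
  show "(\<lambda>x. c *\<^sub>R x + b) \<in> lebesgue \<rightarrow>\<^sub>M lebesgue"
    using lebesgue_affine_measurable[of "\<lambda>_. c" b] assms by (simp add: *)
qed

lemma lebesgue_sets_affine:
  fixes A :: "'a::euclidean_space set"
  assumes c: "c \<noteq> 0" and A: "A \<in> sets lebesgue"
  shows "(\<lambda>x. c *\<^sub>R x + b) ` A \<in> sets lebesgue"
proof -
  have "(\<lambda>x. inverse c *\<^sub>R x + (- inverse c *\<^sub>R b)) -` A \<inter> space lebesgue \<in> sets lebesgue"
    using c by (intro measurable_sets[OF lebesgue_affine(2) A]) auto
  moreover have "(\<lambda>x. inverse c *\<^sub>R x + (- inverse c *\<^sub>R b)) -` A = (\<lambda>x. c *\<^sub>R x + b) ` A"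
  proof (intro equalityI subsetI)
    fix x assume "x \<in> (\<lambda>x. inverse c *\<^sub>R x + (- inverse c *\<^sub>R b)) -` A"
    moreover have "x = c *\<^sub>R (inverse c *\<^sub>R x + (- inverse c *\<^sub>R b)) + b"
      using c by (simp add: scaleR_add_right scaleR_diff_right)
    ultimately show "x \<in> (\<lambda>x. c *\<^sub>R x + b) ` A" by blast
  qed (use c in \<open>auto simp: scaleR_add_right scaleR_diff_right\<close>)
  ultimately show ?thesis by simp
qed

lemma affine_image_indicator:
  fixes A :: "'a::real_vector set"
  assumes "c \<noteq> 0"
  shows "indicator ((\<lambda>x. c *\<^sub>R x + b) ` A) (c *\<^sub>R x + b) = indicator A x"
  using assms by (auto simp: indicator_def)

lemma lebesgue_on_affine_measurable:
  fixes F :: "'a::euclidean_space \<Rightarrow> 'b::euclidean_space"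
  assumes c: "c \<noteq> 0" and A: "A \<in> sets lebesgue"
    and F: "F \<in> borel_measurable (lebesgue_on ((\<lambda>x. c *\<^sub>R x + b) ` A))"
  shows "(\<lambda>x. F (c *\<^sub>R x + b)) \<in> borel_measurable (lebesgue_on A)"
proof -
  let ?B = "(\<lambda>x. c *\<^sub>R x + b) ` A"
  have "(\<lambda>x. indicator ?B x *\<^sub>R F x) \<in> borel_measurable lebesgue"
    using F lebesgue_sets_affine[OF c A] borel_measurable_restrict_space_iff[of ?B lebesgue F] by simp
  from measurable_compose[OF lebesgue_affine(2)[OF c, of b] this]
  have "(\<lambda>x. indicator A x *\<^sub>R F (c *\<^sub>R x + b)) \<in> borel_measurable lebesgue"
    by (simp only: affine_image_indicator[OF c])
  then show ?thesis
    using A borel_measurable_restrict_space_iff[of A lebesgue "\<lambda>x. F (c *\<^sub>R x + b)"] by simp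
qed

lemma lebesgue_on_affine_integral:
  fixes F :: "'a::euclidean_space \<Rightarrow> 'b::euclidean_space"
  assumes c: "c \<noteq> 0" and A: "A \<in> sets lebesgue"
    and F: "F \<in> borel_measurable (lebesgue_on ((\<lambda>x. c *\<^sub>R x + b) ` A))"
  shows "integrable (lebesgue_on ((\<lambda>x. c *\<^sub>R x + b) ` A)) F \<longleftrightarrow>
      integrable (lebesgue_on A) (\<lambda>x. F (c *\<^sub>R x + b))"
    and "(LINT x|lebesgue_on ((\<lambda>x. c *\<^sub>R x + b) ` A). F x) =
      \<bar>c\<bar> ^ DIM('a) *\<^sub>R (LINT x|lebesgue_on A. F (c *\<^sub>R x + b))"
proof -
  let ?B = "(\<lambda>x. c *\<^sub>R x + b) ` A"
  let ?T = "\<lambda>x. c *\<^sub>R x + b"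
  define H where "H x = indicator ?B x *\<^sub>R F x" for x
  note B = lebesgue_sets_affine[OF c A, of b]
  have T: "?T \<in> lebesgue \<rightarrow>\<^sub>M lebesgue" by (rule lebesgue_affine(2)[OF c])
  have H: "H \<in> borel_measurable lebesgue"
    unfolding H_def using F B borel_measurable_restrict_space_iff[of ?B lebesgue F] by simp
  have HT: "H (?T x) = indicator A x *\<^sub>R F (?T x)" for x
    unfolding H_def affine_image_indicator[OF c] ..
  have H': "H \<in> borel_measurable (distr lebesgue lebesgue ?T)"
    using H by simp
  have "integrable lebesgue H \<longleftrightarrow> integrable (density (distr lebesgue lebesgue ?T) (\<lambda>_. ennreal (\<bar>c\<bar> ^ DIM('a)))) H"
    by (subst lebesgue_affine(1)[OF c, of b]) (rule refl)
  also have "\<dots> \<longleftrightarrow> integrable (distr lebesgue lebesgue ?T) (\<lambda>x. \<bar>c\<bar> ^ DIM('a) *\<^sub>R H x)"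
    by (rule integrable_density[OF H']) auto
  also have "\<dots> \<longleftrightarrow> integrable (distr lebesgue lebesgue ?T) H"
  proof
    assume "integrable (distr lebesgue lebesgue ?T) (\<lambda>x. \<bar>c\<bar> ^ DIM('a) *\<^sub>R H x)"
    then have "integrable (distr lebesgue lebesgue ?T) (\<lambda>x. inverse (\<bar>c\<bar> ^ DIM('a)) *\<^sub>R \<bar>c\<bar> ^ DIM('a) *\<^sub>R H x)"
      by (rule integrable_scaleR_right)
    then show "integrable (distr lebesgue lebesgue ?T) H"
      using c by simp
  qed (intro integrable_scaleR_right)
  also have "\<dots> \<longleftrightarrow> integrable lebesgue (\<lambda>x. H (?T x))"
    by (rule integrable_distr_eq[OF T H])
  finally show "integrable (lebesgue_on ?B) F \<longleftrightarrow> integrable (lebesgue_on A) (\<lambda>x. F (?T x))"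
    using A B by (simp add: integrable_restrict_space H_def[symmetric] HT[symmetric])
  have "integral\<^sup>L lebesgue H = integral\<^sup>L (density (distr lebesgue lebesgue ?T) (\<lambda>_. ennreal (\<bar>c\<bar> ^ DIM('a)))) H"
    by (subst lebesgue_affine(1)[OF c, of b]) (rule refl)
  also have "\<dots> = (LINT x|distr lebesgue lebesgue ?T. \<bar>c\<bar> ^ DIM('a) *\<^sub>R H x)"
    by (rule integral_density[OF H']) auto
  also have "\<dots> = \<bar>c\<bar> ^ DIM('a) *\<^sub>R (LINT x|distr lebesgue lebesgue ?T. H x)"
    by simp
  also have "(LINT x|distr lebesgue lebesgue ?T. H x) = (LINT x|lebesgue. H (?T x))"
    by (rule integral_distr[OF T H])
  finally show "(LINT x|lebesgue_on ?B. F x) = \<bar>c\<bar> ^ DIM('a) *\<^sub>R (LINT x|lebesgue_on A. F (?T x))"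
    using A B by (simp add: integral_restrict_space H_def[symmetric] HT[symmetric])
qed

section \<open>The frame on a layer\<close>

text \<open>
  A sum over the frame index set is computed one guide star at a time.
\<close>

lemma has_sum_frame_idx:
  fixes F :: "nat \<times> int \<times> int \<Rightarrow> 'b::topological_comm_monoid_add"
  assumes "\<And>g. g < stars P \<Longrightarrow> ((\<lambda>(j, k). F (g, j, k)) has_sum S g) UNIV"
  shows "(F has_sum (\<Sum>g<stars P. S g)) (frame_idx P)"
proof -
  have "(F has_sum (\<Sum>g<stars P. S g)) (\<Union>g\<in>{..<stars P}. Pair g ` UNIV)"
  proof (rule sum_has_sum)
    fix g assume "g \<in> {..<stars P}"
    then have "((F \<circ> Pair g) has_sum S g) UNIV"
      using assms[of g] by (simp add: o_def case_prod_beta')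
    then show "(F has_sum S g) (Pair g ` UNIV)"
      by (subst has_sum_reindex) (auto simp: inj_on_def)
  qed auto
  moreover have "(\<Union>g\<in>{..<stars P}. Pair g ` UNIV) = frame_idx P"
    by (auto simp: frame_idx_def)
  ultimately show ?thesis by simp
qed

locale valid_layer =
  fixes P :: tomography and l :: nat
  assumes valid: "valid_tomography P" and l: "l < layers P"
begin

lemma period_pos: "0 < period P"
  and aperture_sets: "aperture P \<in> sets lebesgue"
  and aperture_subset: "aperture P \<subseteq> period_square P"
  using valid by (auto simp: valid_tomography_def)

lemma cone_pos: "0 < cone P l g"
proof -
  have mono: "strict_mono_on {..<layers P} (height P)" and h0: "0 \<le> height P 0"
    and top: "height P (layers P - 1) < lgs_height P"
    using valid by (auto simp: valid_tomography_def)
  have "height P 0 \<le> height P l"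
    using mono l by (intro strict_mono_on_leD[OF mono]) auto
  moreover have "height P l \<le> height P (layers P - 1)"
    using mono l by (intro strict_mono_on_leD[OF mono]) auto
  ultimately have "0 \<le> height P l" "height P l < lgs_height P"
    using h0 top by auto
  then show ?thesis by (simp add: cone_def)
qed

definition shift :: "nat \<Rightarrow> real \<times> real" where
  "shift g = height P l *\<^sub>R direction P g"

text \<open>
  The contribution of the layer to the data of guide star \<open>g\<close>: the summand \<open>l\<close> of the tomography
  operator.
\<close>

definition view :: "nat \<Rightarrow> (real \<times> real \<Rightarrow> complex) \<Rightarrow> real \<times> real \<Rightarrow> complex" where
  "view g f r = f (cone P l g *\<^sub>R r + shift g)"

text \<open>
  The entry of \<open>A\<^sub>j\<^sub>k\<close> in row \<open>g\<close> that belongs to the layer.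
\<close>

definition entry :: "nat \<Rightarrow> int \<Rightarrow> int \<Rightarrow> complex" where
  "entry g j k = complex_of_real (2 * period P * inverse (cone P l g))
     * w P j k ((height P l / cone P l g) *\<^sub>R direction P g)"

lemma footprint_eq: "footprint P l g = (\<lambda>x. cone P l g *\<^sub>R x + shift g) ` aperture P"
  by (simp add: footprint_def shift_def)

lemma footprint_sets: "footprint P l g \<in> sets lebesgue"
  unfolding footprint_eq using cone_pos[of g] by (intro lebesgue_sets_affine aperture_sets) simp

lemma layer_domain_sets: "layer_domain P l \<in> sets lebesgue"
  unfolding layer_domain_def using footprint_sets by (intro sets.finite_UN) auto

lemma footprint_subset: "g < stars P \<Longrightarrow> footprint P l g \<subseteq> layer_domain P l"
  unfolding layer_domain_def by blast

lemma layer_finite: "finite_measure (layer_measure P l)"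
proof (rule finite_measure_lebesgue_on)
  have "bounded (aperture P)"
    using aperture_subset by (rule bounded_subset[rotated]) (simp add: period_square_cbox)
  then have "bounded (footprint P l g)" for g
    using bounded_translation[OF bounded_scaling, of "aperture P" "shift g" "cone P l g"]
    by (simp add: footprint_eq image_image add.commute)
  then have "bounded (layer_domain P l)"
    unfolding layer_domain_def by (intro bounded_UN) auto
  then show "layer_domain P l \<in> lmeasurable"
    using layer_domain_sets by (rule bounded_set_imp_lmeasurable)
qed

lemma layer_frame_L2: "layer_frame P l i \<in> L2 (layer_measure P l)"
proof (cases i)
  case (fields g j k)
  let ?c = "cone P l g"
  let ?f = "\<lambda>x. complex_of_real (inverse ?c) * w P j k (x /\<^sub>R ?c)"
  have f: "?f \<in> L2 (layer_measure P l)"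
  proof (rule L2_bounded[OF layer_finite, where B = "inverse ?c * (1 / (2 * period P))"])
    show "?f \<in> borel_measurable (layer_measure P l)"
      by (intro continuous_imp_measurable_on_sets_lebesgue layer_domain_sets continuous_intros
          continuous_on_compose2[OF continuous_on_w[of UNIV]]) auto
    show "cmod (?f x) \<le> inverse ?c * (1 / (2 * period P))" for x
      using cone_pos[of g] cmod_w[OF period_pos] by (simp add: norm_mult norm_inverse)
  qed
  have "(\<lambda>x. indicator (footprint P l g) x * ?f x) \<in> L2 (layer_measure P l)"
  proof (rule L2_bounded_mult[OF f, where B = 1])
    have "indicator (footprint P l g) \<in> borel_measurable lebesgue"
      using footprint_sets by (rule borel_measurable_indicator)
    then show "(indicator (footprint P l g) :: _ \<Rightarrow> complex) \<in> borel_measurable (layer_measure P l)"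
      by (rule measurable_restrict_space1)
  qed (simp add: indicator_def)
  then show ?thesis
    by (simp add: layer_frame_def fields mult.commute)
qed

lemma footprint_integral:
  fixes F :: "real \<times> real \<Rightarrow> 'b::euclidean_space"
  assumes g: "g < stars P" and F: "F \<in> borel_measurable (layer_measure P l)"
  shows "(LINT x|layer_measure P l. indicator (footprint P l g) x *\<^sub>R F x) =
      (cone P l g)\<^sup>2 *\<^sub>R (LINT r|aperture_measure P. F (cone P l g *\<^sub>R r + shift g))"
proof -
  have c: "cone P l g \<noteq> 0" using cone_pos[of g] by simp
  have "F \<in> borel_measurable (lebesgue_on (footprint P l g))"
    using F footprint_subset[OF g] by (rule measurable_restrict_mono)
  then have "(LINT x|lebesgue_on (footprint P l g). F x) =
      (cone P l g)\<^sup>2 *\<^sub>R (LINT r|aperture_measure P. F (cone P l g *\<^sub>R r + shift g))"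
    using lebesgue_on_affine_integral(2)[OF c aperture_sets, where b = "shift g" and F = F] cone_pos[of g]
    by (simp add: footprint_eq power2_eq_square)
  then show ?thesis
    by (simp only: lebesgue_on_subset_integral(2)[OF footprint_sets layer_domain_sets footprint_subset[OF g], of F])
qed

lemma indicator_footprint_measurable:
  "(indicator (footprint P l g) :: _ \<Rightarrow> real) \<in> borel_measurable (layer_measure P l)"
  by (rule measurable_restrict_space1[OF borel_measurable_indicator[OF footprint_sets]])

lemma integrable_on_footprint:
  assumes f: "f \<in> L2 (layer_measure P l)"
  shows "integrable (layer_measure P l) (\<lambda>x. indicator (footprint P l g) x * (cmod (f x))\<^sup>2)"
proof (rule Bochner_Integration.integrable_bound[OF L2_integrable_norm[OF f]])
  show "(\<lambda>x. indicator (footprint P l g) x * (cmod (f x))\<^sup>2) \<in> borel_measurable (layer_measure P l)"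
    using indicator_footprint_measurable L2_measurable[OF f] by measurable
qed (auto simp: indicator_def)

lemma view_L2:
  assumes g: "g < stars P" and f: "f \<in> L2 (layer_measure P l)"
  shows "view g f \<in> L2 (aperture_measure P)"
proof -
  have c: "cone P l g \<noteq> 0" using cone_pos[of g] by simp
  have meas: "f \<in> borel_measurable (lebesgue_on ((\<lambda>x. cone P l g *\<^sub>R x + shift g) ` aperture P))"
    using measurable_restrict_mono[OF L2_measurable[OF f] footprint_subset[OF g]] by (simp add: footprint_eq)
  have "integrable (lebesgue_on (footprint P l g)) (\<lambda>x. (cmod (f x))\<^sup>2)"
  proof (subst lebesgue_on_subset_integral(1)[OF footprint_sets layer_domain_sets footprint_subset[OF g]])
    show "integrable (layer_measure P l) (\<lambda>x. indicator (footprint P l g) x *\<^sub>R (cmod (f x))\<^sup>2)"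
      using integrable_on_footprint[OF f] by simp
  qed
  then have "integrable (aperture_measure P) (\<lambda>r. (cmod (f (cone P l g *\<^sub>R r + shift g)))\<^sup>2)"
    unfolding footprint_eq
    by (rule lebesgue_on_affine_integral(1)[OF c aperture_sets, THEN iffD1, rotated]) (use meas in measurable)
  then show ?thesis
    unfolding view_def by (intro L2I lebesgue_on_affine_measurable[OF c aperture_sets meas])
qed

lemma cmod_entry: "cmod (entry g j k) = inverse (cone P l g)"
  unfolding entry_def norm_mult cmod_w[OF period_pos] using cone_pos[of g] period_pos
  by (simp add: norm_mult norm_inverse)

lemma entry_times_cnj: "entry g j k * cnj (entry g j k) = complex_of_real (inverse ((cone P l g)\<^sup>2))"
  unfolding complex_norm_square[symmetric] cmod_entry by (simp add: power_inverse)

text \<open>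
  Substituting \<open>x = c r + \<alpha> h\<close> turns \<open>w\<^sub>j\<^sub>k(x / c)\<close> into \<open>w\<^sub>j\<^sub>k(r + \<alpha> h / c)\<close>, and the translation
  splits off as a factor.  The Jacobian contributes \<open>c\<^sup>2\<close>.
\<close>

lemma inner_layer_frame:
  assumes g: "g < stars P" and f: "f \<in> L2 (layer_measure P l)"
  shows "L2_inner (layer_measure P l) f (layer_frame P l (g, j, k)) =
    (cone P l g)\<^sup>2 * cnj (entry g j k) * L2_inner (aperture_measure P) (view g f) (w P j k)"
proof -
  let ?c = "cone P l g"
  let ?F = "\<lambda>x. f x * cnj (complex_of_real (inverse ?c) * w P j k (x /\<^sub>R ?c))"
  have c: "?c \<noteq> 0" using cone_pos[of g] by simp
  have [measurable]: "(\<lambda>x. w P j k (x /\<^sub>R ?c)) \<in> borel_measurable (layer_measure P l)"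
    by (intro continuous_imp_measurable_on_sets_lebesgue layer_domain_sets continuous_intros
        continuous_on_compose2[OF continuous_on_w[of UNIV]]) auto
  have [measurable]: "f \<in> borel_measurable (layer_measure P l)"
    using f by (rule L2_measurable)
  have "L2_inner (layer_measure P l) f (layer_frame P l (g, j, k)) =
      (LINT x|layer_measure P l. indicator (footprint P l g) x *\<^sub>R ?F x)"
    unfolding L2_inner_def
    by (intro Bochner_Integration.integral_cong) (auto simp: layer_frame_def indicator_def)
  also have "\<dots> = ?c\<^sup>2 *\<^sub>R (LINT r|aperture_measure P. ?F (?c *\<^sub>R r + shift g))"
    by (rule footprint_integral[OF g]) measurable
  also have "(LINT r|aperture_measure P. ?F (?c *\<^sub>R r + shift g)) =
      (LINT r|aperture_measure P. cnj (entry g j k) * (view g f r * cnj (w P j k r)))"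
  proof (intro Bochner_Integration.integral_cong refl)
    fix r
    have "(?c *\<^sub>R r + shift g) /\<^sub>R ?c = r + (height P l / ?c) *\<^sub>R direction P g"
      using c by (simp add: shift_def scaleR_add_right divide_inverse mult.commute)
    then show "?F (?c *\<^sub>R r + shift g) = cnj (entry g j k) * (view g f r * cnj (w P j k r))"
      by (simp add: w_add[OF period_pos] entry_def view_def)
  qed
  also have "\<dots> = cnj (entry g j k) * L2_inner (aperture_measure P) (view g f) (w P j k)"
    by (simp add: L2_inner_def)
  finally show ?thesis
    by (simp add: scaleR_conv_of_real mult.assoc)
qed

text \<open>
  The preceding identity solved for the data coefficient, using \<open>|entry|\<^sup>2 = c\<^sup>-\<^sup>2\<close>.
\<close>

lemma inner_view:
  assumes g: "g < stars P" and f: "f \<in> L2 (layer_measure P l)"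
  shows "L2_inner (aperture_measure P) (view g f) (w P j k) =
    entry g j k * L2_inner (layer_measure P l) f (layer_frame P l (g, j, k))"
proof -
  have "entry g j k * L2_inner (layer_measure P l) f (layer_frame P l (g, j, k)) =
      (cone P l g)\<^sup>2 * (entry g j k * cnj (entry g j k)) * L2_inner (aperture_measure P) (view g f) (w P j k)"
    by (simp add: inner_layer_frame[OF g f] mult_ac)
  then show ?thesis
    unfolding entry_times_cnj using cone_pos[of g] by simp
qed

text \<open>
  Parseval on the aperture, transported by the affine map.  The factor \<open>c\<^sup>2\<close> left over from the
  coefficients is the Jacobian of the norm.
\<close>

lemma footprint_Parseval:
  assumes g: "g < stars P" and f: "f \<in> L2 (layer_measure P l)"
  shows "((\<lambda>(j, k). (cmod (L2_inner (layer_measure P l) f (layer_frame P l (g, j, k))))\<^sup>2)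
    has_sum (LINT x|layer_measure P l. indicator (footprint P l g) x * (cmod (f x))\<^sup>2)) UNIV"
proof -
  have [measurable]: "f \<in> borel_measurable (layer_measure P l)"
    using f by (rule L2_measurable)
  have "(cmod (L2_inner (layer_measure P l) f (layer_frame P l (g, j, k))))\<^sup>2 =
      (cone P l g)\<^sup>2 * (cmod (L2_inner (aperture_measure P) (view g f) (w P j k)))\<^sup>2" for j k
    using cone_pos[of g]
    by (simp add: inner_layer_frame[OF g f] norm_mult norm_power cmod_entry power2_eq_square)
  moreover have "((\<lambda>i. (cone P l g)\<^sup>2 * (case i of (j, k) \<Rightarrow> (cmod (L2_inner (aperture_measure P) (view g f) (w P j k)))\<^sup>2))
      has_sum (cone P l g)\<^sup>2 * (L2_norm (aperture_measure P) (view g f))\<^sup>2) UNIV"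
    by (intro has_sum_cmult_right Parseval_subset period_pos aperture_sets aperture_subset view_L2 g f)
  moreover have "(cone P l g)\<^sup>2 * (L2_norm (aperture_measure P) (view g f))\<^sup>2 =
      (LINT x|layer_measure P l. indicator (footprint P l g) x * (cmod (f x))\<^sup>2)"
    using footprint_integral[OF g, of "\<lambda>x. (cmod (f x))\<^sup>2"] by (simp add: L2_norm_squared view_def)
  ultimately show ?thesis
    by (simp add: case_prod_beta')
qed

definition multiplicity_of :: "real \<times> real \<Rightarrow> real" where
  "multiplicity_of x = (\<Sum>g<stars P. indicator (footprint P l g) x)"

text \<open>
  Summing the identities for the footprints produces the weight \<open>N\<close>.  It is at least \<open>1\<close> because the
  footprints cover the layer domain.
\<close>

sublocale multiplier_frame "layer_measure P l" "frame_idx P" "layer_frame P l" multiplicity_of "real (stars P)"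
proof
  show "layer_frame P l i \<in> L2 (layer_measure P l)" for i
    by (rule layer_frame_L2)
  show N: "multiplicity_of \<in> borel_measurable (layer_measure P l)"
    unfolding multiplicity_of_def[abs_def] by (intro borel_measurable_sum indicator_footprint_measurable)
  show "1 \<le> multiplicity_of x" if "x \<in> space (layer_measure P l)" for x
  proof -
    obtain g where g: "g < stars P" "x \<in> footprint P l g"
      using \<open>x \<in> space (layer_measure P l)\<close> by (auto simp: layer_domain_def)
    have "indicator (footprint P l g) x \<le> multiplicity_of x"
      unfolding multiplicity_of_def using g(1) by (intro member_le_sum) auto
    then show ?thesis using g(2) by simp
  qed
  show "multiplicity_of x \<le> real (stars P)" for x
    unfolding multiplicity_of_def using sum_bounded_above[of "{..<stars P}" "\<lambda>g. indicator (footprint P l g) x" "1::real"]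
    by (simp add: indicator_def)
  fix f assume f: "f \<in> L2 (layer_measure P l)"
  have "((\<lambda>i. (cmod (L2_inner (layer_measure P l) f (layer_frame P l i)))\<^sup>2) has_sum
      (\<Sum>g<stars P. LINT x|layer_measure P l. indicator (footprint P l g) x * (cmod (f x))\<^sup>2)) (frame_idx P)"
    by (rule has_sum_frame_idx) (rule footprint_Parseval[OF _ f])
  also have "(\<Sum>g<stars P. LINT x|layer_measure P l. indicator (footprint P l g) x * (cmod (f x))\<^sup>2) =
      (LINT x|layer_measure P l. multiplicity_of x * (cmod (f x))\<^sup>2)"
    unfolding multiplicity_of_def sum_distrib_right
    by (intro Bochner_Integration.integral_sum[symmetric] integrable_on_footprint f)
  finally show "((\<lambda>i. (cmod (L2_inner (layer_measure P l) f (layer_frame P l i)))\<^sup>2) has_sum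
      (LINT x|layer_measure P l. multiplicity_of x * (cmod (f x))\<^sup>2)) (frame_idx P)" .
qed

end

section \<open>Singular systems and minimum-norm solutions\<close>

lemma cscalar_prod_sum:
  "u \<in> carrier_vec d \<Longrightarrow> y \<bullet>c u = (\<Sum>i<d. vec_index y i * cnj (vec_index u i))"
  by (simp add: scalar_prod_def lessThan_atLeast0 conjugate_complex_def)

text \<open>
  A vector \<open>x = A\<^sup>H q\<close> lies in the span of the right singular vectors \<open>v n\<close>, with coefficients \<open>t n\<close>
  say, and \<open>y = A x\<close> then has coefficients \<open>s n * t n\<close> along the \<open>u n\<close>.  Dividing by the singular
  values recovers \<open>x\<close>, so the pseudoinverse of \<open>A\<close> maps \<open>y\<close> to \<open>x\<close>.
\<close>

lemma singular_system_minimum_norm: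
  assumes ss: "singular_system A s u v"
    and x: "\<And>c. c < dim_col A \<Longrightarrow> x c = (\<Sum>i<dim_row A. cnj (index_mat A (i, c)) * q i)"
    and y: "\<And>i. i < dim_row A \<Longrightarrow> vec_index y i = (\<Sum>c<dim_col A. index_mat A (i, c) * x c)"
    and c: "c < dim_col A"
  shows "(\<Sum>n<mat_rank A. (y \<bullet>c u n) / complex_of_real (s n) * vec_index (v n) c) = x c"
proof -
  let ?r = "mat_rank A"
  have s: "\<And>n. n < ?r \<Longrightarrow> s n > 0"
    and u: "\<And>n. n < ?r \<Longrightarrow> u n \<in> carrier_vec (dim_row A)"
    and uu: "\<And>m n. m < ?r \<Longrightarrow> n < ?r \<Longrightarrow> u m \<bullet>c u n = (if m = n then 1 else 0)"
    and v: "\<And>n. n < ?r \<Longrightarrow> v n \<in> carrier_vec (dim_col A)"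
    and vv: "\<And>m n. m < ?r \<Longrightarrow> n < ?r \<Longrightarrow> v m \<bullet>c v n = (if m = n then 1 else 0)"
    and A: "\<And>z i. z \<in> carrier_vec (dim_col A) \<Longrightarrow> i < dim_row A \<Longrightarrow>
        vec_index (mult_mat_vec A z) i = (\<Sum>n<?r. complex_of_real (s n) * (z \<bullet>c v n) * vec_index (u n) i)"
    using ss by (auto simp: singular_system_def orthonormal_fam_def)
  have apply_A: "vec_index (mult_mat_vec A (Matrix.vec (dim_col A) z)) i = (\<Sum>c<dim_col A. index_mat A (i, c) * z c)"
    if "i < dim_row A" for z i
    using that by (simp add: scalar_prod_def lessThan_atLeast0)
  have inner_v: "Matrix.vec (dim_col A) z \<bullet>c v n = (\<Sum>c<dim_col A. z c * cnj (vec_index (v n) c))" if "n < ?r" for z n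
    by (simp add: cscalar_prod_sum[OF v[OF that]])
  have entries: "index_mat A (i, c) = (\<Sum>n<?r. complex_of_real (s n) * cnj (vec_index (v n) c) * vec_index (u n) i)"
    if "i < dim_row A" "c < dim_col A" for i c
  proof -
    have "index_mat A (i, c) = (\<Sum>c'<dim_col A. index_mat A (i, c') * (if c' = c then 1 else 0))"
      using that by (simp add: if_distrib cong: if_cong)
    also have "\<dots> = (\<Sum>n<?r. complex_of_real (s n) *
        (\<Sum>c'<dim_col A. (if c' = c then 1 else 0) * cnj (vec_index (v n) c')) * vec_index (u n) i)"
      unfolding apply_A[OF that(1), symmetric]
      by (subst A) (auto simp: that inner_v intro!: sum.cong)
    also have "\<dots> = (\<Sum>n<?r. complex_of_real (s n) * cnj (vec_index (v n) c) * vec_index (u n) i)"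
      using that by (intro sum.cong refl) (simp add: if_distribR if_distrib cong: if_cong)
    finally show ?thesis .
  qed
  define t where "t n = complex_of_real (s n) * (\<Sum>i<dim_row A. cnj (vec_index (u n) i) * q i)" for n
  \<comment> \<open>\<open>x\<close> is in the range of the adjoint, hence in the span of the vectors \<open>v n\<close>\<close>
  have x_span: "x c = (\<Sum>n<?r. t n * vec_index (v n) c)" if "c < dim_col A" for c
  proof -
    have "x c = (\<Sum>i<dim_row A. \<Sum>n<?r. complex_of_real (s n) * vec_index (v n) c * cnj (vec_index (u n) i) * q i)"
      unfolding x[OF that] using that by (intro sum.cong refl) (simp add: entries cnj_sum sum_distrib_right)
    also have "\<dots> = (\<Sum>n<?r. t n * vec_index (v n) c)"
      unfolding t_def by (subst sum.swap) (simp add: sum_distrib_left sum_distrib_right mult_ac)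
    finally show ?thesis .
  qed
  have coeff: "(\<Sum>c<dim_col A. x c * cnj (vec_index (v n) c)) = t n" if n: "n < ?r" for n
  proof -
    have "(\<Sum>c<dim_col A. x c * cnj (vec_index (v n) c)) =
        (\<Sum>c<dim_col A. \<Sum>m<?r. t m * (vec_index (v m) c * cnj (vec_index (v n) c)))"
      by (intro sum.cong refl) (simp add: x_span sum_distrib_right mult.assoc)
    also have "\<dots> = (\<Sum>m<?r. t m * (v m \<bullet>c v n))"
      by (subst sum.swap) (simp add: cscalar_prod_sum[OF v[OF n]] sum_distrib_left)
    also have "\<dots> = t n"
      using n by (simp add: vv if_distrib cong: if_cong)
    finally show ?thesis .
  qed
  have y_expand: "vec_index y i = (\<Sum>n<?r. complex_of_real (s n) * t n * vec_index (u n) i)" if "i < dim_row A" for i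
    unfolding y[OF that] apply_A[OF that, symmetric]
    by (subst A) (auto simp: that inner_v coeff intro!: sum.cong)
  have y_coeff: "y \<bullet>c u n = complex_of_real (s n) * t n" if n: "n < ?r" for n
  proof -
    have "y \<bullet>c u n = (\<Sum>i<dim_row A. \<Sum>m<?r. complex_of_real (s m) * t m * (vec_index (u m) i * cnj (vec_index (u n) i)))"
      unfolding cscalar_prod_sum[OF u[OF n]]
      by (intro sum.cong refl) (simp add: y_expand sum_distrib_right mult.assoc)
    also have "\<dots> = (\<Sum>m<?r. complex_of_real (s m) * t m * (u m \<bullet>c u n))"
      by (subst sum.swap) (simp add: cscalar_prod_sum[OF u[OF n]] sum_distrib_left)
    also have "\<dots> = complex_of_real (s n) * t n"
      using n by (simp add: uu if_distrib cong: if_cong)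
    finally show ?thesis .
  qed
  have "(\<Sum>n<?r. (y \<bullet>c u n) / complex_of_real (s n) * vec_index (v n) c) = (\<Sum>n<?r. t n * vec_index (v n) c)"
  proof (intro sum.cong refl)
    fix n assume "n \<in> {..<?r}"
    then have "n < ?r" by simp
    then show "(y \<bullet>c u n) / complex_of_real (s n) * vec_index (v n) c = t n * vec_index (v n) c"
      using s[of n] by (simp add: y_coeff)
  qed
  then show ?thesis
    using x_span[OF c] by simp
qed

text \<open>
  Among the solutions \<open>z\<close> of one linear equation the multiple of the conjugated coefficient vector is
  the shortest: the difference to any other solution is orthogonal to it.
\<close>

lemma minimum_norm_scalar_equation:
  fixes e z :: "nat \<Rightarrow> complex"
  assumes \<sigma>: "(\<Sum>l<n. e l * cnj (e l)) = complex_of_real \<sigma>" "0 < \<sigma>"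
    and y: "(\<Sum>l<n. e l * z l) = y"
  shows "(\<Sum>l<n. (cmod (cnj (e l) * (y / complex_of_real \<sigma>)))\<^sup>2) \<le> (\<Sum>l<n. (cmod (z l))\<^sup>2)"
proof -
  define a where "a l = cnj (e l) * (y / complex_of_real \<sigma>)" for l
  have "(\<Sum>l<n. (z l - a l) * cnj (a l)) = 0"
  proof -
    define c where "c = y / complex_of_real \<sigma>"
    have "(z l - a l) * cnj (a l) = (e l * z l) * cnj c - (e l * cnj (e l)) * (c * cnj c)" for l
      by (simp add: a_def c_def[symmetric] algebra_simps)
    then have "(\<Sum>l<n. (z l - a l) * cnj (a l)) =
        (\<Sum>l<n. e l * z l) * cnj c - (\<Sum>l<n. e l * cnj (e l)) * (c * cnj c)"
      by (simp add: sum_subtractf sum_distrib_right)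
    also have "\<dots> = ((\<Sum>l<n. e l * z l) - (\<Sum>l<n. e l * cnj (e l)) * (y / complex_of_real \<sigma>)) * cnj (y / complex_of_real \<sigma>)"
      by (simp add: c_def algebra_simps)
    finally show ?thesis using \<sigma> y by simp
  qed
  then have cross: "(\<Sum>l<n. Re ((z l - a l) * cnj (a l))) = 0"
    by (metis Re_sum zero_complex.sel(1))
  have "(cmod (z l))\<^sup>2 = (cmod (a l))\<^sup>2 + (cmod (z l - a l))\<^sup>2 + 2 * Re ((z l - a l) * cnj (a l))" for l
    unfolding cmod_power2 by (simp add: power2_eq_square algebra_simps)
  then have "(\<Sum>l<n. (cmod (z l))\<^sup>2) = (\<Sum>l<n. (cmod (a l))\<^sup>2) + (\<Sum>l<n. (cmod (z l - a l))\<^sup>2)"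
    using cross by (simp add: sum.distrib flip: sum_distrib_left)
  then show ?thesis
    unfolding a_def by (simp add: sum_nonneg)
qed

section \<open>The tomography equation in Fourier coefficients\<close>

context
  fixes P :: tomography
  assumes valid: "valid_tomography P"
begin

lemma valid_layerI: "l < layers P \<Longrightarrow> valid_layer P l"
  using valid by unfold_locales

abbreviation "layer_entry \<equiv> valid_layer.entry P"

lemma layers_pos: "0 < layers P"
  using valid by (simp add: valid_tomography_def)

text \<open>
  Row \<open>g\<close> of the block diagonal matrix sees only the columns \<open>l + g L\<close>.
\<close>

lemma sum_block:
  fixes F :: "nat \<Rightarrow> complex"
  assumes g: "g < stars P"
  shows "(\<Sum>c<layers P * stars P. if c div layers P = g then F c else 0) = (\<Sum>l<layers P. F (l + g * layers P))"
proof -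
  have "(\<Sum>l<layers P. F (l + g * layers P)) =
      (\<Sum>c\<in>(\<lambda>l. l + g * layers P) ` {..<layers P}. F c)"
    by (subst sum.reindex) (auto simp: inj_on_def)
  also have "\<dots> = (\<Sum>c<layers P * stars P. if c div layers P = g then F c else 0)"
  proof (rule sum.mono_neutral_cong_left)
    show "(\<lambda>l. l + g * layers P) ` {..<layers P} \<subseteq> {..<layers P * stars P}"
    proof
      fix c assume "c \<in> (\<lambda>l. l + g * layers P) ` {..<layers P}"
      then obtain l where "l < layers P" "c = l + g * layers P" by blast
      moreover have "(g + 1) * layers P \<le> stars P * layers P"
        using g by (intro mult_right_mono) auto
      ultimately show "c \<in> {..<layers P * stars P}" by (simp add: algebra_simps)
    qed
    show "\<forall>c\<in>{..<layers P * stars P} - (\<lambda>l. l + g * layers P) ` {..<layers P}.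
        (if c div layers P = g then F c else 0) = 0"
    proof (intro ballI)
      fix c assume c: "c \<in> {..<layers P * stars P} - (\<lambda>l. l + g * layers P) ` {..<layers P}"
      have "c div layers P \<noteq> g"
      proof
        assume "c div layers P = g"
        then have "c = c mod layers P + g * layers P" by (metis mod_div_mult_eq add.commute)
        moreover have "c mod layers P < layers P" using layers_pos by simp
        ultimately show False using c by blast
      qed
      then show "(if c div layers P = g then F c else 0) = 0" by simp
    qed
  qed (auto simp: layers_pos)
  finally show ?thesis ..
qed

lemma sum_entry_norm:
  "(\<Sum>l<layers P. layer_entry l g j k * cnj (layer_entry l g j k)) = complex_of_real ((row_norm P g)\<^sup>2)"
proof -
  have "(\<Sum>l<layers P. layer_entry l g j k * cnj (layer_entry l g j k)) = complex_of_real (\<Sum>l<layers P. inverse ((cone P l g)\<^sup>2))"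
    unfolding of_real_sum by (intro sum.cong refl) (simp add: valid_layer.entry_times_cnj[OF valid_layerI])
  also have "(\<Sum>l<layers P. inverse ((cone P l g)\<^sup>2)) = (row_norm P g)\<^sup>2"
    by (simp add: row_norm_def sum_nonneg)
  finally show ?thesis .
qed

lemma row_norm_pos: "0 < (row_norm P g)\<^sup>2"
proof -
  have "0 < (\<Sum>l<layers P. inverse ((cone P l g)\<^sup>2))"
  proof (rule sum_pos)
    fix l assume "l \<in> {..<layers P}"
    then have "0 < cone P l g" by (intro valid_layer.cone_pos[OF valid_layerI]) simp
    then show "0 < inverse ((cone P l g)\<^sup>2)" by simp
  qed (use layers_pos in auto)
  then show ?thesis by (simp add: row_norm_def)
qed

lemma a_seq_eq:
  assumes l: "l < layers P" and g: "g < stars P"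
  shows "a_seq P \<phi> l (g, j, k) =
    cnj (layer_entry l g j k) * (L2_inner (aperture_measure P) (\<phi> g) (w P j k) / complex_of_real ((row_norm P g)\<^sup>2))"
proof -
  have "a_seq P \<phi> l (g, j, k) = complex_of_real (2 * period P * (inverse (cone P l g) / (row_norm P g)\<^sup>2))
      * cnj (w P j k ((height P l / cone P l g) *\<^sub>R direction P g)) * L2_inner (aperture_measure P) (\<phi> g) (w P j k)"
    using g by (simp only: a_seq_def w_uminus) (simp add: frame_idx_def data_coeff_def)
  then show ?thesis
    unfolding valid_layer.entry_def[OF valid_layerI[OF l]] by (simp add: divide_inverse)
qed

text \<open>
  \<open>A A\<^sup>H\<close> is diagonal with entries \<open>\<sigma>\<^sub>g\<^sup>2\<close>, so \<open>q g = \<phi>\<^sub>g / \<sigma>\<^sub>g\<^sup>2\<close> satisfies \<open>A (A\<^sup>H q) = \<phi>\<close>, and the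
  pseudoinverse maps the data to \<open>A\<^sup>H q\<close>, whose components are those of \<open>a_seq\<close>.
\<close>

lemma inv_coeff_eq_a_seq:
  assumes ss: "\<And>j k. singular_system (tomo_mat P j k) (s j k) (u j k) (v j k)" and l: "l < layers P"
  shows "inv_coeff P s u v \<phi> l = a_seq P \<phi> l"
proof
  fix i :: "nat \<times> int \<times> int"
  obtain g j k where i: "i = (g, j, k)" by (cases i)
  show "inv_coeff P s u v \<phi> l i = a_seq P \<phi> l i"
  proof (cases "g < stars P")
    case False
    then show ?thesis by (simp add: i inv_coeff_def a_seq_def frame_idx_def)
  next
    case g: True
    let ?A = "tomo_mat P j k"
    let ?L = "layers P"
    define q where "q g = L2_inner (aperture_measure P) (\<phi> g) (w P j k) / complex_of_real ((row_norm P g)\<^sup>2)" for g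
    define x where "x c = cnj (layer_entry (c mod ?L) (c div ?L) j k) * q (c div ?L)" for c
    have dims: "dim_row ?A = stars P" "dim_col ?A = ?L * stars P"
      by (simp_all add: tomo_mat_def)
    have A: "index_mat ?A (g, c) = (if c div ?L = g then layer_entry (c mod ?L) g j k else 0)"
      if "g < stars P" "c < ?L * stars P" for g c
    proof -
      have "c mod ?L < ?L" using layers_pos by simp
      from valid_layer.entry_def[OF valid_layerI[OF this]] show ?thesis
        using that by (simp add: tomo_mat_def Let_def)
    qed
    have col: "l + g * ?L < ?L * stars P"
    proof -
      have "(g + 1) * ?L \<le> stars P * ?L"
        using g by (intro mult_right_mono) auto
      then show ?thesis using l by (simp add: algebra_simps)
    qed
    have "(\<Sum>n<mat_rank ?A. (data_coeff P \<phi> j k \<bullet>c u j k n) / complex_of_real (s j k n)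
        * vec_index (v j k n) (l + g * ?L)) = x (l + g * ?L)"
    proof (rule singular_system_minimum_norm[OF ss, where q = q])
      show "l + g * ?L < dim_col ?A" using col by (simp add: dims)
      fix c assume "c < dim_col ?A"
      then have c: "c < ?L * stars P" by (simp add: dims)
      then have "c div ?L < stars P" by (simp add: less_mult_imp_div_less mult.commute)
      then have "x c = (\<Sum>i<stars P. if i = c div ?L then cnj (layer_entry (c mod ?L) i j k) * q i else 0)"
        by (simp add: x_def)
      also have "\<dots> = (\<Sum>i<stars P. cnj (index_mat ?A (i, c)) * q i)"
        using c by (intro sum.cong refl) (auto simp: A)
      finally show "x c = (\<Sum>i<dim_row ?A. cnj (index_mat ?A (i, c)) * q i)"
        by (simp add: dims)
    next
      fix i assume "i < dim_row ?A"
      then have i: "i < stars P" by (simp add: dims)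
      have "(\<Sum>c<?L * stars P. index_mat ?A (i, c) * x c) =
          (\<Sum>c<?L * stars P. if c div ?L = i then layer_entry (c mod ?L) i j k * x c else 0)"
        using i by (intro sum.cong refl) (auto simp: A)
      also have "\<dots> = (\<Sum>l<?L. layer_entry l i j k * cnj (layer_entry l i j k) * q i)"
        unfolding sum_block[OF i] x_def by (intro sum.cong refl) (simp add: mult.assoc)
      also have "\<dots> = complex_of_real ((row_norm P i)\<^sup>2) * q i"
        unfolding sum_entry_norm[of i j k, symmetric] sum_distrib_right ..
      also have "\<dots> = vec_index (data_coeff P \<phi> j k) i"
        using i row_norm_pos[of i] by (simp add: q_def data_coeff_def)
      finally show "vec_index (data_coeff P \<phi> j k) i = (\<Sum>c<dim_col ?A. index_mat ?A (i, c) * x c)"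
        by (simp add: dims)
    qed
    also have "x (l + g * ?L) = a_seq P \<phi> l (g, j, k)"
      using l by (simp add: x_def q_def a_seq_eq[OF l g])
    finally show ?thesis
      using g by (simp add: i inv_coeff_def frame_idx_def)
  qed
qed

lemma w_L2_aperture: "w P j k \<in> L2 (aperture_measure P)"
proof -
  interpret valid_layer P 0 by (rule valid_layerI[OF layers_pos])
  have "finite_measure (aperture_measure P)"
    using aperture_sets aperture_subset
    by (intro finite_measure_lebesgue_on bounded_set_imp_lmeasurable)
      (auto intro: bounded_subset[OF bounded_cbox] simp: period_square_cbox)
  then show ?thesis
    by (rule L2_bounded[where B = "1 / (2 * period P)"])
      (auto simp: cmod_w[OF period_pos] intro!: continuous_imp_measurable_on_sets_lebesgue continuous_on_w aperture_sets)
qed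

text \<open>
  In Fourier coefficients the tomography operator acts as the matrices \<open>A\<^sub>j\<^sub>k\<close> on the frame
  coefficients of the layers.
\<close>

lemma tomo_op_L2:
  assumes \<psi>: "\<psi> \<in> tomo_domain P" and g: "g < stars P"
  shows "tomo_op P \<psi> g \<in> L2 (aperture_measure P)"
    and "L2_inner (aperture_measure P) (tomo_op P \<psi> g) (w P j k) =
      (\<Sum>l<layers P. layer_entry l g j k * L2_inner (layer_measure P l) (\<psi> l) (layer_frame P l (g, j, k)))"
proof -
  have L2: "\<psi> l \<in> L2 (layer_measure P l)" if "l < layers P" for l
    using \<psi> that by (auto simp: tomo_domain_def)
  have eq: "tomo_op P \<psi> g = (\<lambda>r. \<Sum>l<layers P. valid_layer.view P l g (\<psi> l) r)"
    unfolding tomo_op_def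
    by (intro ext sum.cong refl) (simp add: valid_layer.view_def[OF valid_layerI] valid_layer.shift_def[OF valid_layerI])
  have view: "valid_layer.view P l g (\<psi> l) \<in> L2 (aperture_measure P)" if "l < layers P" for l
    by (rule valid_layer.view_L2[OF valid_layerI[OF that] g L2[OF that]])
  show "tomo_op P \<psi> g \<in> L2 (aperture_measure P)"
    unfolding eq using view by (intro L2_sum) auto
  show "L2_inner (aperture_measure P) (tomo_op P \<psi> g) (w P j k) =
      (\<Sum>l<layers P. layer_entry l g j k * L2_inner (layer_measure P l) (\<psi> l) (layer_frame P l (g, j, k)))"
    unfolding eq using view w_L2_aperture[of j k]
    by (subst L2_inner_sum_left) (auto intro!: sum.cong simp: valid_layer.inner_view[OF valid_layerI g L2])
qed

lemma AE_zero_if_coeffs_zero: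
  assumes f: "f \<in> L2 (aperture_measure P)"
    and zero: "\<And>j k. L2_inner (aperture_measure P) f (w P j k) = 0"
  shows "AE r in aperture_measure P. f r = 0"
proof -
  interpret valid_layer P 0 by (rule valid_layerI[OF layers_pos])
  have "((\<lambda>(j, k). (cmod (L2_inner (aperture_measure P) f (w P j k)))\<^sup>2) has_sum
      (L2_norm (aperture_measure P) f)\<^sup>2) UNIV"
    by (rule Parseval_subset[OF period_pos aperture_sets aperture_subset f])
  then have zero_sum: "((\<lambda>_ :: int \<times> int. 0) has_sum (L2_norm (aperture_measure P) f)\<^sup>2) UNIV"
    by (simp add: zero case_prod_unfold)
  have "L2_norm (aperture_measure P) f = 0"
    using has_sum_unique[OF zero_sum has_sum_0_simp] by simp
  then show ?thesis by (rule L2_norm_eq_0_imp_AE[OF f])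
qed

text \<open>
  The frame coefficients of every solution satisfy the scalar equations of which \<open>a_seq\<close> gives the
  minimum-norm solutions.
\<close>

lemma a_seq_energy_le:
  assumes \<psi>: "is_solution P \<phi> \<psi>" and \<phi>: "\<phi> \<in> tomo_codomain P" and g: "g < stars P"
  shows "(\<Sum>l<layers P. (cmod (a_seq P \<phi> l (g, j, k)))\<^sup>2) \<le>
    (\<Sum>l<layers P. (cmod (L2_inner (layer_measure P l) (\<psi> l) (layer_frame P l (g, j, k))))\<^sup>2)"
proof -
  have dom: "\<psi> \<in> tomo_domain P" and ae: "AE r in aperture_measure P. tomo_op P \<psi> g r = \<phi> g r"
    using \<psi> g by (auto simp: is_solution_def L2_eq_def)
  have "\<phi> g \<in> L2 (aperture_measure P)"
    using \<phi> g by (auto simp: tomo_codomain_def)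
  then have eq: "L2_inner (aperture_measure P) (tomo_op P \<psi> g) (w P j k) = L2_inner (aperture_measure P) (\<phi> g) (w P j k)"
  proof -
    interpret valid_layer P 0 by (rule valid_layerI[OF layers_pos])
    have "w P j k \<in> borel_measurable (aperture_measure P)"
      by (intro continuous_imp_measurable_on_sets_lebesgue continuous_on_w aperture_sets)
    then show ?thesis
      using ae L2_measurable[OF tomo_op_L2(1)[OF dom g]] L2_measurable[OF \<open>\<phi> g \<in> _\<close>]
      by (intro L2_inner_cong_AE) auto
  qed
  have "(\<Sum>l<layers P. (cmod (a_seq P \<phi> l (g, j, k)))\<^sup>2) = (\<Sum>l<layers P.
      (cmod (cnj (layer_entry l g j k) * (L2_inner (aperture_measure P) (\<phi> g) (w P j k) / complex_of_real ((row_norm P g)\<^sup>2))))\<^sup>2)"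
    by (intro sum.cong refl) (simp add: a_seq_eq g)
  also have "\<dots> \<le> (\<Sum>l<layers P. (cmod (L2_inner (layer_measure P l) (\<psi> l) (layer_frame P l (g, j, k))))\<^sup>2)"
    by (rule minimum_norm_scalar_equation[OF sum_entry_norm row_norm_pos])
      (simp add: tomo_op_L2(2)[OF dom g, symmetric] eq)
  finally show ?thesis .
qed

end

section \<open>Unordered sums\<close>

lemma sum_infsum_ennreal:
  fixes F :: "'b \<Rightarrow> 'a \<Rightarrow> ennreal"
  assumes "finite I"
  shows "(\<Sum>l\<in>I. \<Sum>\<^sub>\<infinity>x\<in>A. F l x) = (\<Sum>\<^sub>\<infinity>x\<in>A. \<Sum>l\<in>I. F l x)"
  using assms
proof (induction I rule: finite_induct)
  case (insert i I)
  have "(\<Sum>\<^sub>\<infinity>x\<in>A. F i x + (\<Sum>l\<in>I. F l x)) = (\<Sum>\<^sub>\<infinity>x\<in>A. F i x) + (\<Sum>\<^sub>\<infinity>x\<in>A. \<Sum>l\<in>I. F l x)"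
    by (intro infsum_add nonneg_summable_on_complete) auto
  then show ?case using insert by simp
qed simp

lemma has_sum_ennreal:
  assumes "(f has_sum S) A" "\<And>x. x \<in> A \<Longrightarrow> 0 \<le> f x"
  shows "((\<lambda>x. ennreal (f x)) has_sum ennreal S) A"
proof -
  have "((\<lambda>F. ennreal (sum f F)) \<longlongrightarrow> ennreal S) (finite_subsets_at_top A)"
    using assms(1) unfolding has_sum_def by (rule tendsto_ennrealI)
  moreover have "\<forall>\<^sub>F F in finite_subsets_at_top A. ennreal (sum f F) = (\<Sum>x\<in>F. ennreal (f x))"
    by (rule eventually_finite_subsets_at_top_weakI) (use assms(2) in \<open>auto intro!: sum_ennreal[symmetric]\<close>)
  ultimately show ?thesis
    unfolding has_sum_def by (rule Lim_transform_eventually)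
qed

lemma frame_idx_energy:
  assumes "(\<lambda>i. (cmod (b i))\<^sup>2) summable_on frame_idx P"
  shows "(\<Sum>g<stars P. \<Sum>\<^sub>\<infinity>(j, k)\<in>UNIV. ennreal ((cmod (b (g, j, k)))\<^sup>2)) =
    ennreal (\<Sum>\<^sub>\<infinity>i\<in>frame_idx P. (cmod (b i))\<^sup>2)"
proof -
  have "((\<lambda>i. ennreal ((cmod (b i))\<^sup>2)) has_sum
      (\<Sum>g<stars P. \<Sum>\<^sub>\<infinity>(j, k)\<in>UNIV. ennreal ((cmod (b (g, j, k)))\<^sup>2))) (frame_idx P)"
    by (intro has_sum_frame_idx has_sum_infsum nonneg_summable_on_complete) auto
  moreover have "((\<lambda>i. ennreal ((cmod (b i))\<^sup>2)) has_sum ennreal (\<Sum>\<^sub>\<infinity>i\<in>frame_idx P. (cmod (b i))\<^sup>2)) (frame_idx P)"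
    using assms by (intro has_sum_ennreal has_sum_infsum) auto
  ultimately show ?thesis by (rule has_sum_unique)
qed

lemma L2_has_sum_cong:
  assumes "\<And>k. k \<in> K \<Longrightarrow> f k = g k"
  shows "L2_has_sum M f K s \<longleftrightarrow> L2_has_sum M g K s"
proof -
  have "((\<lambda>F. L2_norm M (\<lambda>x. s x - (\<Sum>k\<in>F. f k x))) \<longlongrightarrow> 0) (finite_subsets_at_top K) \<longleftrightarrow>
      ((\<lambda>F. L2_norm M (\<lambda>x. s x - (\<Sum>k\<in>F. g k x))) \<longlongrightarrow> 0) (finite_subsets_at_top K)"
  proof (intro tendsto_cong eventually_finite_subsets_at_top_weakI)
    fix F assume "F \<subseteq> K"
    then have "(\<Sum>k\<in>F. f k x) = (\<Sum>k\<in>F. g k x)" for x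
      using assms by (intro sum.cong) auto
    then show "L2_norm M (\<lambda>x. s x - (\<Sum>k\<in>F. f k x)) = L2_norm M (\<lambda>x. s x - (\<Sum>k\<in>F. g k x))"
      by simp
  qed
  then show ?thesis
    using assms by (auto simp: L2_has_sum_def)
qed

section \<open>The reconstruction theorem\<close>

theorem theorem4p8:
  fixes P :: tomography
    and s :: "int \<Rightarrow> int \<Rightarrow> nat \<Rightarrow> real"
    and u v :: "int \<Rightarrow> int \<Rightarrow> nat \<Rightarrow> complex Matrix.vec"
    and \<phi> :: "nat \<Rightarrow> real \<times> real \<Rightarrow> complex"
  assumes "valid_tomography P"
    and "\<And>j k. singular_system (tomo_mat P j k) (s j k) (u j k) (v j k)"
    and "\<phi> \<in> tomo_codomain P"
    and "\<And>l. l < layers P \<Longrightarrow> a_seq P \<phi> l \<in> layer_frame_op P l ` L2 (layer_measure P l)"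
  shows "is_solution P \<phi> (tomo_inv P s u v \<phi>) \<and>
    (\<forall>\<psi>. is_solution P \<phi> \<psi> \<longrightarrow>
       (\<Sum>g<stars P. \<Sum>l<layers P. \<Sum>\<^sub>\<infinity>(j, k)\<in>UNIV. ennreal ((cmod
          (L2_inner (layer_measure P l) (tomo_inv P s u v \<phi> l) (layer_frame P l (g, j, k))))\<^sup>2))
     \<le> (\<Sum>g<stars P. \<Sum>l<layers P. \<Sum>\<^sub>\<infinity>(j, k)\<in>UNIV. ennreal ((cmod
          (L2_inner (layer_measure P l) (\<psi> l) (layer_frame P l (g, j, k))))\<^sup>2))) \<and>
    (\<forall>l<layers P.
       inv_coeff P s u v \<phi> l = a_seq P \<phi> l \<and>
       L2_has_sum (layer_measure P l) (\<lambda>i x. a_seq P \<phi> l i * layer_dual_frame P l i x)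
         (frame_idx P) (tomo_inv P s u v \<phi> l) \<and>
       (\<forall>b\<in>ell2 (frame_idx P).
          L2_has_sum (layer_measure P l) (\<lambda>i x. b i * layer_dual_frame P l i x)
            (frame_idx P) (tomo_inv P s u v \<phi> l) \<longrightarrow>
          b \<noteq> a_seq P \<phi> l \<longrightarrow>
          (\<Sum>g<stars P. \<Sum>\<^sub>\<infinity>(j, k)\<in>UNIV. ennreal ((cmod (b (g, j, k)))\<^sup>2))
            > (\<Sum>g<stars P. \<Sum>\<^sub>\<infinity>(j, k)\<in>UNIV. ennreal ((cmod (a_seq P \<phi> l (g, j, k)))\<^sup>2))))"
proof -
  note valid = assms(1) and ss = assms(2) and \<phi> = assms(3) and range = assms(4)
  let ?R = "tomo_inv P s u v \<phi>"
  have coeffs: "inv_coeff P s u v \<phi> l = a_seq P \<phi> l" if "l < layers P" for l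
    by (rule inv_coeff_eq_a_seq[OF valid ss that])
  have expansion: "L2_has_sum (layer_measure P l) (\<lambda>i x. a_seq P \<phi> l i * layer_dual_frame P l i x)
      (frame_idx P) (?R l)"
    and R_coeff: "\<And>i. i \<in> frame_idx P \<Longrightarrow> L2_inner (layer_measure P l) (?R l) (layer_frame P l i) = a_seq P \<phi> l i"
    if l: "l < layers P" for l
  proof -
    interpret valid_layer P l by (rule valid_layerI[OF valid l])
    \<comment> \<open>by reconstruction, the range hypothesis provides component \<open>l\<close> of the inverse itself\<close>
    obtain f where f: "f \<in> L2 (layer_measure P l)" and a: "a_seq P \<phi> l = layer_frame_op P l f"
      using range[OF l] by blast
    have a_i: "a_seq P \<phi> l i = L2_inner (layer_measure P l) f (layer_frame P l i)" if "i \<in> frame_idx P" for i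
      using that by (simp add: a layer_frame_op_def frame_op_def)
    have f_sum: "L2_has_sum (layer_measure P l) (\<lambda>i x. a_seq P \<phi> l i * layer_dual_frame P l i x) (frame_idx P) f"
      using dual_expansion[OF f]
      by (rule L2_has_sum_cong[THEN iffD1, rotated]) (simp add: a_i layer_dual_frame_def)
    from someI[of "L2_has_sum (layer_measure P l) (\<lambda>i x. a_seq P \<phi> l i * layer_dual_frame P l i x) (frame_idx P)", OF f_sum]
    show R_sum: "L2_has_sum (layer_measure P l) (\<lambda>i x. a_seq P \<phi> l i * layer_dual_frame P l i x)
        (frame_idx P) (?R l)"
      unfolding tomo_inv_def L2_infsum_def coeffs[OF l] .
    show "L2_inner (layer_measure P l) (?R l) (layer_frame P l i) = a_seq P \<phi> l i" if "i \<in> frame_idx P" for i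
      using has_sum_unique[OF L2_has_sum_inner[OF R_sum layer_frame_L2] L2_has_sum_inner[OF f_sum layer_frame_L2]]
      by (simp add: a_i[OF that])
  qed
  have R_dom: "?R \<in> tomo_domain P"
    using expansion by (auto simp: tomo_domain_def L2_has_sum_def)
  have solution: "is_solution P \<phi> ?R"
    unfolding is_solution_def L2_eq_def
  proof (intro conjI allI impI R_dom)
    fix g assume g: "g < stars P"
    let ?d = "\<lambda>r. tomo_op P ?R g r - \<phi> g r"
    have \<phi>g: "\<phi> g \<in> L2 (aperture_measure P)"
      using \<phi> g by (auto simp: tomo_codomain_def)
    have op: "tomo_op P ?R g \<in> L2 (aperture_measure P)"
      by (rule tomo_op_L2(1)[OF valid R_dom g])
    have "AE r in aperture_measure P. ?d r = 0"
    proof (rule AE_zero_if_coeffs_zero[OF valid])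
      show "?d \<in> L2 (aperture_measure P)"
        by (rule L2_diff[OF op \<phi>g])
      fix j k
      let ?y = "L2_inner (aperture_measure P) (\<phi> g) (w P j k)"
      let ?E = "\<lambda>l. valid_layer.entry P l g j k"
      have "L2_inner (aperture_measure P) (tomo_op P ?R g) (w P j k) =
          (\<Sum>l<layers P. ?E l * L2_inner (layer_measure P l) (?R l) (layer_frame P l (g, j, k)))"
        by (rule tomo_op_L2(2)[OF valid R_dom g])
      also have "\<dots> = (\<Sum>l<layers P. ?E l * cnj (?E l) * (?y / complex_of_real ((row_norm P g)\<^sup>2)))"
        using g by (intro sum.cong refl) (simp add: R_coeff frame_idx_def a_seq_eq[OF valid])
      also have "\<dots> = complex_of_real ((row_norm P g)\<^sup>2) * (?y / complex_of_real ((row_norm P g)\<^sup>2))"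
        unfolding sum_distrib_right[symmetric] sum_entry_norm[OF valid] ..
      also have "\<dots> = ?y"
        using row_norm_pos[OF valid, of g] by simp
      finally show "L2_inner (aperture_measure P) ?d (w P j k) = 0"
        using L2_inner_diff_left[OF op \<phi>g w_L2_aperture[OF valid]] by simp
    qed
    then show "AE r in aperture_measure P. tomo_op P ?R g r = \<phi> g r"
      by simp
  qed
  have minimal: "(\<Sum>g<stars P. \<Sum>l<layers P. \<Sum>\<^sub>\<infinity>(j, k)\<in>UNIV. ennreal ((cmod
          (L2_inner (layer_measure P l) (?R l) (layer_frame P l (g, j, k))))\<^sup>2))
     \<le> (\<Sum>g<stars P. \<Sum>l<layers P. \<Sum>\<^sub>\<infinity>(j, k)\<in>UNIV. ennreal ((cmod
          (L2_inner (layer_measure P l) (\<psi> l) (layer_frame P l (g, j, k))))\<^sup>2))"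
    if \<psi>: "is_solution P \<phi> \<psi>" for \<psi>
  proof (rule sum_mono)
    fix g assume "g \<in> {..<stars P}"
    then have g: "g < stars P" by simp
    have le: "(\<Sum>l<layers P. ennreal ((cmod (L2_inner (layer_measure P l) (?R l) (layer_frame P l (g, j, k))))\<^sup>2))
        \<le> (\<Sum>l<layers P. ennreal ((cmod (L2_inner (layer_measure P l) (\<psi> l) (layer_frame P l (g, j, k))))\<^sup>2))" for j k
    proof -
      have "(\<Sum>l<layers P. (cmod (L2_inner (layer_measure P l) (?R l) (layer_frame P l (g, j, k))))\<^sup>2) =
          (\<Sum>l<layers P. (cmod (a_seq P \<phi> l (g, j, k)))\<^sup>2)"
        using g by (intro sum.cong refl) (simp add: R_coeff frame_idx_def)
      also have "\<dots> \<le> (\<Sum>l<layers P. (cmod (L2_inner (layer_measure P l) (\<psi> l) (layer_frame P l (g, j, k))))\<^sup>2)"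
        by (rule a_seq_energy_le[OF valid \<psi> \<phi> g])
      finally show ?thesis
        by (simp add: sum_ennreal sum_nonneg ennreal_leI)
    qed
    show "(\<Sum>l<layers P. \<Sum>\<^sub>\<infinity>(j, k)\<in>UNIV. ennreal ((cmod
          (L2_inner (layer_measure P l) (?R l) (layer_frame P l (g, j, k))))\<^sup>2))
     \<le> (\<Sum>l<layers P. \<Sum>\<^sub>\<infinity>(j, k)\<in>UNIV. ennreal ((cmod
          (L2_inner (layer_measure P l) (\<psi> l) (layer_frame P l (g, j, k))))\<^sup>2))"
      unfolding sum_infsum_ennreal[OF finite_lessThan]
      by (intro infsum_mono nonneg_summable_on_complete) (use le in \<open>auto simp: case_prod_unfold\<close>)
  qed
  have economical: "(\<Sum>g<stars P. \<Sum>\<^sub>\<infinity>(j, k)\<in>UNIV. ennreal ((cmod (a_seq P \<phi> l (g, j, k)))\<^sup>2))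
      < (\<Sum>g<stars P. \<Sum>\<^sub>\<infinity>(j, k)\<in>UNIV. ennreal ((cmod (b (g, j, k)))\<^sup>2))"
    if l: "l < layers P" and b: "b \<in> ell2 (frame_idx P)" and ne: "b \<noteq> a_seq P \<phi> l"
      and b_sum: "L2_has_sum (layer_measure P l) (\<lambda>i x. b i * layer_dual_frame P l i x) (frame_idx P) (?R l)"
    for l b
  proof -
    interpret valid_layer P l by (rule valid_layerI[OF valid l])
    let ?a = "a_seq P \<phi> l"
    have R: "?R l \<in> L2 (layer_measure P l)"
      using expansion[OF l] by (simp add: L2_has_sum_def)
    have b_summable: "(\<lambda>i. (cmod (b i))\<^sup>2) summable_on frame_idx P" and b_ext: "b \<in> extensional (frame_idx P)"
      using b by (auto simp: ell2_def)
    have a_summable: "(\<lambda>i. (cmod (?a i))\<^sup>2) summable_on frame_idx P"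
      using has_sum_imp_summable[OF weighted_Parseval[OF R]]
      by (rule summable_on_cong[THEN iffD1, rotated]) (simp add: R_coeff[OF l])
    note energy = dual_expansion_energy[OF R b_summable b_sum[unfolded layer_dual_frame_def]]
    have eq: "(\<Sum>\<^sub>\<infinity>i\<in>frame_idx P. (cmod (b i))\<^sup>2) = (\<Sum>\<^sub>\<infinity>i\<in>frame_idx P. (cmod (?a i))\<^sup>2)
        + (\<Sum>\<^sub>\<infinity>i\<in>frame_idx P. (cmod (b i - ?a i))\<^sup>2)"
      unfolding energy(1) by (intro arg_cong2[where f = "(+)"] infsum_cong) (simp_all add: R_coeff[OF l])
    have diff_summable: "(\<lambda>i. (cmod (b i - ?a i))\<^sup>2) summable_on frame_idx P"
      using energy(2) by (rule summable_on_cong[THEN iffD1, rotated]) (simp add: R_coeff[OF l])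
    have "?a \<in> extensional (frame_idx P)"
      by (simp add: a_seq_def)
    then obtain i where i: "i \<in> frame_idx P" "b i \<noteq> ?a i"
      using ne b_ext extensionalityI by blast
    have "0 < (cmod (b i - ?a i))\<^sup>2"
      using i(2) by simp
    also have "\<dots> \<le> (\<Sum>\<^sub>\<infinity>i\<in>frame_idx P. (cmod (b i - ?a i))\<^sup>2)"
      using finite_sum_le_infsum[OF diff_summable, of "{i}"] i(1) by simp
    finally have "(\<Sum>\<^sub>\<infinity>i\<in>frame_idx P. (cmod (?a i))\<^sup>2) < (\<Sum>\<^sub>\<infinity>i\<in>frame_idx P. (cmod (b i))\<^sup>2)"
      unfolding eq by simp
    then show ?thesis
      unfolding frame_idx_energy[OF a_summable] frame_idx_energy[OF b_summable]
      by (simp add: ennreal_less_iff infsum_nonneg)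
  qed
  show ?thesis
    using solution minimal coeffs expansion economical by blast
qed

end
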